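(* Let $\psi:S^2\to \mathrm{U}(n)$ be a harmonic map with uniton number $r>0$, let $W=\Psi\mathcal{H}_+$ be a normalized extended solution of $\psi$, and let $X:S^2\to G_k(\mathbb{C}^{rn})$ be the corresponding holomorphic map, defined by $X=W\cap\bigoplus_{j=0}^{r-1}\lambda^j\mathbb{C}^n$ under the identification $\mathbb{C}^{rn}\cong\bigoplus_{j=0}^{r-1}\lambda^j\mathbb{C}^n$. Then $\psi$ is an immersion if and only if $X$ is an immersion. Moreover, in this case, the induced metrics coincide: $X^*h_{rn}=\psi^*h_n$.
   Context: Metrics: $\mathrm{U}(n)$ carries the bi-invariant metric $h_n(\xi,\eta)=\frac18\mathrm{tr}(\xi\eta^* )$, $\xi,\eta\in\mathfrak{u}(n)$. The Grassmannian $G_k(\mathbb{C}^N)$ of $k$-dimensional complex subspaces of $\mathbb{C}^N$ carries the metric, also denoted $h_N$, induced from $(\mathrm{U}(N),h_N)$ by the Cartan embedding $Y\mapsto\pi_Y-\pi_Y^\perp$, where $\pi_Y,\pi_Y^\perp$ are the orthogonal projections onto $Y$ and $Y^\perp$. $S^2$ is the Riemann sphere with local complex coordinate $z$. Extended solutions: for smooth $\psi:S^2\to \mathrm{U}(n)$ write $\frac12\psi^{-1}d\psi=A^\psi_z dz+A^\psi_{\bar z}d\bar z$. If $\psi$ is harmonic, an extended solution of $\psi$ is a smooth map $\Psi:S^2\to\Omega \mathrm{U}(n)=\{\gamma:S^1\to \mathrm{U}(n)\text{ smooth}:\gamma(1)=I_n\}$ with $\Psi^{-1}d\Psi=(1-\lambda^{-1})A^\psi_zdz+(1-\lambda)A^\psi_{\bar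 z}d\bar z$ for all $\lambda\in S^1$; it is unique up to left multiplication by a constant loop. Let $\mathcal{H}_+\subset L^2(S^1,\mathbb{C}^n)$ be the closed subspace of Fourier series with vanishing negative coefficients. $\Psi$ is identified with the subbundle $W=\Psi\mathcal{H}_+$ of $S^2\times L^2(S^1,\mathbb{C}^n)$, with fibers $W(z)=\Psi(z)\mathcal{H}_+$; it is a holomorphic subbundle with $\lambda W\subset W$ and $\lambda\partial_z\Gamma(W)\subset\Gamma(W)$. The uniton number of $\psi$ is the smallest $r$ for which $\psi$ has a polynomial extended solution $\Psi=\sum_{i=0}^r\lambda^iA_i$. If $\psi$ has uniton number $r$, a normalized extended solution of $\psi$ is one with $\lambda^r\mathcal{H}_+\subset W\subset\mathcal{H}_+$ such that $\bigcup_{z\in S^2}W(z)$ spans $\mathcal{H}_+$. The intersection $W\cap\bigoplus_{j=0}^{r-1}\lambda^j\mathbb{C}^n$ has constant rank $k<rn$ away from a finite subset of $S^2$, and $X$ denotes its holomorphic extension to all of $S^2$ ("filling out zeros"), so that $W=X\oplus\lambda^r\mathcal{H}_+$ orthogonally. $\bigoplus_{j=0}^{r-1}\lambda^j\mathbb{C}^n$ carries the $L^2$ Hermitian inner product, for which the vectors $\lambda^je_i$ ($e_i$ the canonical basis of $\mathbb{C}^n$) form a unitary basis. *)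

theory Defs
  imports "HOL-Analysis.Analysis"
begin

section \<open>Smooth maps on the Riemann sphere\<close>

primrec Ck_on :: "nat \<Rightarrow> 'a::real_normed_vector set \<Rightarrow> ('a \<Rightarrow> 'b::real_normed_vector) \<Rightarrow> bool" where
  "Ck_on 0 S f \<longleftrightarrow> continuous_on S f"
| "Ck_on (Suc k) S f \<longleftrightarrow> (\<forall>x\<in>S. f differentiable (at x)) \<and>
     (\<forall>v. Ck_on k S (\<lambda>x. frechet_derivative f (at x) v))"

text \<open>\<open>C\<^sup>\<infinity>\<close> on an open set \<open>S\<close> of a finite-dimensional space: iterated directional
  derivatives of all orders exist and are continuous.\<close>

definition smooth_on :: "'a::real_normed_vector set \<Rightarrow> ('a \<Rightarrow> 'b::real_normed_vector) \<Rightarrow> bool" where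
  "smooth_on S f \<longleftrightarrow> (\<forall>k. Ck_on k S f)"

datatype riemann_sphere = Finite_Point complex | Infinity_Point

definition chart_zero :: "complex \<Rightarrow> riemann_sphere" where
  "chart_zero z = Finite_Point z"

definition chart_infinity :: "complex \<Rightarrow> riemann_sphere" where
  "chart_infinity w = (if w = 0 then Infinity_Point else Finite_Point (1 / w))"

text \<open>The standard holomorphic atlas, given by the inverses \<open>\<complex> \<rightarrow> S\<^sup>2\<close> of the coordinate maps.
  Every notion on \<open>S\<^sup>2\<close> below is read in these two coordinates.\<close>

definition sphere_charts :: "(complex \<Rightarrow> riemann_sphere) set" where
  "sphere_charts = {chart_zero, chart_infinity}"

definition sphere_smooth :: "(riemann_sphere \<Rightarrow> 'a::real_normed_vector) \<Rightarrow> bool" where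
  "sphere_smooth f \<longleftrightarrow> (\<forall>c\<in>sphere_charts. smooth_on UNIV (\<lambda>z. f (c z)))"

definition sphere_immersion :: "(riemann_sphere \<Rightarrow> 'a::real_normed_vector) \<Rightarrow> bool" where
  "sphere_immersion f \<longleftrightarrow>
     (\<forall>c\<in>sphere_charts. \<forall>z. \<exists>D. ((\<lambda>x. f (c x)) has_derivative D) (at z) \<and> inj D)"


section \<open>The unitary group and its metric\<close>

definition cscale :: "complex \<Rightarrow> complex^'n^'m \<Rightarrow> complex^'n^'m" (infixr \<open>*\<^sub>M\<close> 75) where
  "c *\<^sub>M A = (\<chi> i j. c * A $ i $ j)"

definition ctranspose :: "complex^'n^'m \<Rightarrow> complex^'m^'n" where
  "ctranspose A = (\<chi> i j. cnj (A $ j $ i))"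

definition unitary_group :: "(complex^'n^'n) set" where
  "unitary_group = {A. A ** ctranspose A = mat 1 \<and> ctranspose A ** A = mat 1}"

text \<open>On skew-Hermitian matrices the trace below is already real, so taking the real part does not
  change the value.\<close>

definition h_lie :: "complex^'n^'n \<Rightarrow> complex^'n^'n \<Rightarrow> real" where
  "h_lie \<xi> \<eta> = Re (trace (\<xi> ** ctranspose \<eta>)) / 8"

text \<open>The invariant metric at \<open>A \<in> U(n)\<close> on tangent vectors \<open>u\<close>, \<open>v\<close> given as matrices.\<close>

definition h_metric :: "complex^'n^'n \<Rightarrow> complex^'n^'n \<Rightarrow> complex^'n^'n \<Rightarrow> real" where
  "h_metric A u v = h_lie (matrix_inv A ** u) (matrix_inv A ** v)"

text \<open>\<open>(f\<^sup>*h)(u, v)\<close> at the point with coordinate \<open>z\<close> in the chart \<open>c\<close>;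
  the tangent vectors \<open>u\<close>, \<open>v\<close> are elements of \<open>\<complex> = \<real>\<^sup>2\<close>.\<close>

definition pullback_metric ::
  "(riemann_sphere \<Rightarrow> complex^'n^'n) \<Rightarrow> (complex \<Rightarrow> riemann_sphere) \<Rightarrow> complex \<Rightarrow> complex \<Rightarrow> complex \<Rightarrow> real" where
  "pullback_metric f c z u v =
     h_metric (f (c z))
       (frechet_derivative (\<lambda>x. f (c x)) (at z) u)
       (frechet_derivative (\<lambda>x. f (c x)) (at z) v)"


section \<open>Harmonic maps\<close>

text \<open>The Dirichlet energy \<open>1/2 \<integral> |df|\<^sup>2\<close> is conformally invariant in dimension two, so it may be
  computed with the flat metric of the chart \<open>chart_zero\<close>, which misses a single point.\<close>

definition energy :: "(riemann_sphere \<Rightarrow> complex^'n^'n) \<Rightarrow> real" where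
  "energy f = (\<integral>z. (pullback_metric f chart_zero z 1 1 + pullback_metric f chart_zero z \<i> \<i>) / 2 \<partial>lborel)"

definition smooth_variation ::
  "(riemann_sphere \<Rightarrow> complex^'n^'n) \<Rightarrow> (real \<Rightarrow> riemann_sphere \<Rightarrow> complex^'n^'n) \<Rightarrow> bool" where
  "smooth_variation \<psi> F \<longleftrightarrow> F 0 = \<psi> \<and> (\<forall>t p. F t p \<in> unitary_group) \<and>
     (\<forall>c\<in>sphere_charts. smooth_on UNIV (\<lambda>(t, z). F t (c z)))"

definition harmonic_map :: "(riemann_sphere \<Rightarrow> complex^'n^'n) \<Rightarrow> bool" where
  "harmonic_map \<psi> \<longleftrightarrow> sphere_smooth \<psi> \<and> (\<forall>p. \<psi> p \<in> unitary_group) \<and>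
     (\<forall>F. smooth_variation \<psi> F \<longrightarrow> ((\<lambda>t. energy (F t)) has_real_derivative 0) (at 0))"


section \<open>Extended solutions\<close>

definition wirtinger_z :: "(complex \<Rightarrow> complex^'n^'n) \<Rightarrow> complex \<Rightarrow> complex^'n^'n" where
  "wirtinger_z f z = (1/2) *\<^sub>M (frechet_derivative f (at z) 1 - \<i> *\<^sub>M frechet_derivative f (at z) \<i>)"

definition wirtinger_zbar :: "(complex \<Rightarrow> complex^'n^'n) \<Rightarrow> complex \<Rightarrow> complex^'n^'n" where
  "wirtinger_zbar f z = (1/2) *\<^sub>M (frechet_derivative f (at z) 1 + \<i> *\<^sub>M frechet_derivative f (at z) \<i>)"

text \<open>The coefficients in \<open>1/2 \<psi>\<inverse> d\<psi> = A_z dz + A_zbar dzbar\<close>, for a map read in a chart.\<close>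

definition A_z :: "(complex \<Rightarrow> complex^'n^'n) \<Rightarrow> complex \<Rightarrow> complex^'n^'n" where
  "A_z \<psi> z = (1/2) *\<^sub>M (matrix_inv (\<psi> z) ** wirtinger_z \<psi> z)"

definition A_zbar :: "(complex \<Rightarrow> complex^'n^'n) \<Rightarrow> complex \<Rightarrow> complex^'n^'n" where
  "A_zbar \<psi> z = (1/2) *\<^sub>M (matrix_inv (\<psi> z) ** wirtinger_zbar \<psi> z)"

text \<open>Loops are functions on all of \<open>\<complex>\<close> of which only the values on the unit circle are used.\<close>

definition loop_group :: "(complex \<Rightarrow> complex^'n^'n) set" where
  "loop_group = {\<gamma>. (\<forall>\<zeta>\<in>sphere 0 1. \<gamma> \<zeta> \<in> unitary_group) \<and> \<gamma> 1 = mat 1 \<and>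
     smooth_on UNIV (\<lambda>t::real. \<gamma> (cis t))}"

text \<open>A map into the loop group is smooth iff its adjoint map \<open>S\<^sup>2 \<times> S\<^sup>1 \<rightarrow> U(n)\<close> is. The equation
  between matrix-valued one-forms is evaluated on a tangent vector \<open>v\<close>, with \<open>dz(v) = v\<close> and
  \<open>dzbar(v) = cnj v\<close>.\<close>

definition extended_solution ::
  "(riemann_sphere \<Rightarrow> complex^'n^'n) \<Rightarrow> (riemann_sphere \<Rightarrow> complex \<Rightarrow> complex^'n^'n) \<Rightarrow> bool" where
  "extended_solution \<psi> \<Psi> \<longleftrightarrow>
     (\<forall>p. \<Psi> p \<in> loop_group) \<and>
     (\<forall>c\<in>sphere_charts. smooth_on UNIV (\<lambda>(z, t::real). \<Psi> (c z) (cis t))) \<and>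
     (\<forall>c\<in>sphere_charts. \<forall>\<zeta>\<in>sphere 0 1. \<forall>z v.
        matrix_inv (\<Psi> (c z) \<zeta>) ** frechet_derivative (\<lambda>x. \<Psi> (c x) \<zeta>) (at z) v =
          ((1 - inverse \<zeta>) * v) *\<^sub>M A_z (\<lambda>x. \<psi> (c x)) z +
          ((1 - \<zeta>) * cnj v) *\<^sub>M A_zbar (\<lambda>x. \<psi> (c x)) z)"

definition has_polynomial_extended_solution :: "(riemann_sphere \<Rightarrow> complex^'n^'n) \<Rightarrow> nat \<Rightarrow> bool" where
  "has_polynomial_extended_solution \<psi> r \<longleftrightarrow>
     (\<exists>\<Psi> A. extended_solution \<psi> \<Psi> \<and>
        (\<forall>p. \<forall>\<zeta>\<in>sphere 0 1. \<Psi> p \<zeta> = (\<Sum>i\<le>r. \<zeta> ^ i *\<^sub>M A i p)))"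

definition has_uniton_number :: "(riemann_sphere \<Rightarrow> complex^'n^'n) \<Rightarrow> nat \<Rightarrow> bool" where
  "has_uniton_number \<psi> r \<longleftrightarrow> has_polynomial_extended_solution \<psi> r \<and>
     (\<forall>s. has_polynomial_extended_solution \<psi> s \<longrightarrow> r \<le> s)"


section \<open>The Hilbert space model\<close>

abbreviation circle_measure :: "real measure" where
  "circle_measure \<equiv> lebesgue_on {0..2 * pi}"

text \<open>Elements of \<open>L\<^sup>2(S\<^sup>1, \<complex>\<^sup>n)\<close> are represented by all functions in the class; all subspaces
  below are closed under changing a function almost everywhere on the circle (and arbitrarily off
  the circle).\<close>

definition L2_circle :: "(complex \<Rightarrow> complex^'n) set" where
  "L2_circle = {f. (\<lambda>t. f (cis t)) \<in> borel_measurable circle_measure \<and>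
     integrable circle_measure (\<lambda>t. (norm (f (cis t)))\<^sup>2)}"

definition fourier_coeff :: "(complex \<Rightarrow> complex^'n) \<Rightarrow> int \<Rightarrow> complex^'n" where
  "fourier_coeff f k = (1 / (2 * pi)) *\<^sub>R (\<integral>t. cis (- (of_int k * t)) *s f (cis t) \<partial>circle_measure)"

definition H_plus :: "(complex \<Rightarrow> complex^'n) set" where
  "H_plus = {f \<in> L2_circle. \<forall>k<0. fourier_coeff f k = 0}"

text \<open>The subspace \<open>\<gamma> S\<close> for a matrix-valued function \<open>\<gamma>\<close> on the circle.\<close>

definition loop_image ::
  "(complex \<Rightarrow> complex^'n^'n) \<Rightarrow> (complex \<Rightarrow> complex^'n) set \<Rightarrow> (complex \<Rightarrow> complex^'n) set" where
  "loop_image \<gamma> S = {g \<in> L2_circle. \<exists>f\<in>S. AE t in circle_measure. g (cis t) = \<gamma> (cis t) *v f (cis t)}"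

definition complex_span :: "(complex \<Rightarrow> complex^'n) set \<Rightarrow> (complex \<Rightarrow> complex^'n) set" where
  "complex_span S = {g. \<exists>B c. finite B \<and> B \<subseteq> S \<and> g = (\<lambda>\<zeta>. \<Sum>f\<in>B. c f *s f \<zeta>)}"

definition W_fiber :: "(riemann_sphere \<Rightarrow> complex \<Rightarrow> complex^'n^'n) \<Rightarrow> riemann_sphere \<Rightarrow> (complex \<Rightarrow> complex^'n) set" where
  "W_fiber \<Psi> p = loop_image (\<Psi> p) H_plus"

definition normalized_extended_solution ::
  "(riemann_sphere \<Rightarrow> complex^'n^'n) \<Rightarrow> nat \<Rightarrow> (riemann_sphere \<Rightarrow> complex \<Rightarrow> complex^'n^'n) \<Rightarrow> bool" where
  "normalized_extended_solution \<psi> r \<Psi> \<longleftrightarrow>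
     has_uniton_number \<psi> r \<and> extended_solution \<psi> \<Psi> \<and>
     (\<forall>p. loop_image (\<lambda>\<zeta>. mat (\<zeta> ^ r)) H_plus \<subseteq> W_fiber \<Psi> p \<and> W_fiber \<Psi> p \<subseteq> H_plus) \<and>
     complex_span (\<Union>p. W_fiber \<Psi> p) = H_plus"


section \<open>Grassmannians\<close>

definition hermitian_prod :: "complex^'m \<Rightarrow> complex^'m \<Rightarrow> complex" where
  "hermitian_prod v w = (\<Sum>i\<in>UNIV. v $ i * cnj (w $ i))"

definition grassmannian :: "nat \<Rightarrow> (complex^'m) set set" where
  "grassmannian k = {Y. vec.subspace Y \<and> vec.dim Y = k}"

definition hermitian_compl :: "(complex^'m) set \<Rightarrow> (complex^'m) set" where
  "hermitian_compl Y = {v. \<forall>w\<in>Y. hermitian_prod v w = 0}"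

definition orth_proj :: "(complex^'m) set \<Rightarrow> complex^'m^'m" where
  "orth_proj Y = (THE P. \<forall>v. P *v v \<in> Y \<and> v - P *v v \<in> hermitian_compl Y)"

definition cartan_embedding :: "(complex^'m) set \<Rightarrow> complex^'m^'m" where
  "cartan_embedding Y = orth_proj Y - orth_proj (hermitian_compl Y)"

text \<open>Differential geometry on the Grassmannian is that of its image in \<open>U(N)\<close>.\<close>

definition grassmann_immersion :: "(riemann_sphere \<Rightarrow> (complex^'m) set) \<Rightarrow> bool" where
  "grassmann_immersion X \<longleftrightarrow> sphere_immersion (\<lambda>p. cartan_embedding (X p))"

definition grassmann_pullback_metric ::
  "(riemann_sphere \<Rightarrow> (complex^'m) set) \<Rightarrow> (complex \<Rightarrow> riemann_sphere) \<Rightarrow> complex \<Rightarrow> complex \<Rightarrow> complex \<Rightarrow> real" where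
  "grassmann_pullback_metric X = pullback_metric (\<lambda>p. cartan_embedding (X p))"

text \<open>Holomorphic maps into the Grassmannian are those locally spanned by a holomorphic frame
  (which is independent, because it has \<open>k\<close> elements and spans a \<open>k\<close>-dimensional space).\<close>

definition holomorphic_to_grassmannian :: "nat \<Rightarrow> (riemann_sphere \<Rightarrow> (complex^'m) set) \<Rightarrow> bool" where
  "holomorphic_to_grassmannian k X \<longleftrightarrow>
     (\<forall>p. X p \<in> grassmannian k) \<and>
     (\<forall>c\<in>sphere_charts. \<forall>z0. \<exists>U s. open U \<and> z0 \<in> U \<and>
        (\<forall>i<k. \<forall>a. (\<lambda>z. s i z $ a) holomorphic_on U) \<and>
        (\<forall>z\<in>U. X (c z) = vec.span ((\<lambda>i. s i z) ` {..<k})))"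

text \<open>The identification of \<open>\<complex>\<^bsup>rn\<^esup>\<close> with \<open>\<Oplus>\<^sub>j \<zeta>\<^sup>j \<complex>\<^sup>n\<close>, \<open>0 \<le> j < r\<close>. Coordinates of \<open>\<complex>\<^bsup>rn\<^esup>\<close> are
  indexed by \<open>'r \<times> 'n\<close>, where the type \<open>'r\<close> has \<open>r\<close> elements, numbered \<open>0, \<dots>, r - 1\<close> by a bijection
  \<open>deg\<close>; the basis vector with index \<open>(a, i)\<close> is sent to \<open>\<zeta>\<^bsup>deg a\<^esup> e\<^sub>i\<close>.\<close>

definition poly_of_vec :: "('r::finite \<Rightarrow> nat) \<Rightarrow> complex^('r \<times> 'n) \<Rightarrow> complex \<Rightarrow> complex^'n" where
  "poly_of_vec deg v \<zeta> = (\<chi> i. \<Sum>a\<in>UNIV. \<zeta> ^ deg a * v $ (a, i))"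

text \<open>\<open>X\<close> is the holomorphic extension across finitely many points of the intersection of
  \<open>W = \<Psi> \<H>\<^sub>+\<close> with the polynomials of degree less than \<open>r\<close>.\<close>

definition corresponding_map ::
  "('r::finite \<Rightarrow> nat) \<Rightarrow> nat \<Rightarrow> (riemann_sphere \<Rightarrow> complex \<Rightarrow> complex^'n^'n) \<Rightarrow>
   (riemann_sphere \<Rightarrow> (complex^('r \<times> 'n)) set) \<Rightarrow> bool" where
  "corresponding_map deg k \<Psi> X \<longleftrightarrow>
     holomorphic_to_grassmannian k X \<and>
     (\<exists>F. finite F \<and> (\<forall>p. p \<notin> F \<longrightarrow> X p = {v. poly_of_vec deg v \<in> W_fiber \<Psi> p}))"

end

theory Submission
  imports Defs "HOL-Complex_Analysis.Cauchy_Integral_Formula"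
begin

text \<open>Because \<open>\<zeta>\<^sup>r \<H>\<^sub>+ \<subseteq> W \<subseteq> \<H>\<^sub>+\<close>, the loop \<open>\<Psi>\<close> is a polynomial \<open>\<Sum>\<^sub>k \<zeta>\<^sup>k T\<^sub>k\<close> of degree at most \<open>r\<close>. Stacking the
  coefficients of \<open>\<zeta>\<^sup>m \<Psi>\<close> of degree \<open>0, \<dots>, r - 1\<close> into block columns \<open>C\<^sub>m\<close>, unitarity of \<open>\<Psi>\<close> shows that
  the orthogonal projection onto \<open>X\<close> is \<open>\<pi> = \<Sum>\<^sub>m\<^sub>\<ge>\<^sub>0 C\<^sub>m C\<^sub>m\<^sup>*\<close>. The equation for \<open>d\<Psi>\<close>, compared coefficient by
  coefficient, makes the derivative of this sum telescope: \<open>d\<pi> = \<sigma> dz + \<sigma>\<^sup>* dzbar\<close> with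
  \<open>\<sigma> = - C\<^sub>-\<^sub>1 A\<^sub>z C\<^sub>0\<^sup>*\<close>, \<open>\<sigma>\<^sup>2 = 0\<close> and \<open>tr (\<sigma> \<sigma>\<^sup>*) = tr (A\<^sub>z A\<^sub>z\<^sup>*)\<close>. On the other side \<open>tr (A\<^sub>z\<^sup>2) dz\<^sup>2\<close> is a
  holomorphic quadratic differential on the sphere, hence zero. So both induced metrics equal
  \<open>tr (A\<^sub>z A\<^sub>z\<^sup>*) |dz|\<^sup>2\<close> everywhere, and either map is an immersion iff this metric is definite.\<close>

section \<open>Complex matrices\<close>

text \<open>The intersection defining X may jump at finitely many points, but \<pi> is built from
  Fourier coefficients of \<Psi>, which exist at every point and are differentiable in z. So \<pi>
  fills out the zeros by itself, and constancy of its rank identifies its range with X everywhere.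
  Truncation to degrees below r spoils orthonormality of the columns; what survives is that those
  with m >= 0 are orthogonal to those with m < 0 and that all together resolve the identity. The
  truncated columns C_0 and C_{-1} miss one coefficient each, T_r and T_0. Since d\<Psi> only has
  degrees 0 to r, the extreme coefficients of its equation say that T_0 kills A_z and T_r kills the
  adjoint of A_z; this repairs the loss and gives the trace identity. Holomorphy of the quadratic
  differential comes from flatness of \<Psi> at two spectral parameters. The constants agree because
  both the Cartan embedding 2 \<pi> - 1 and the 1/2 in the definition of A_z put a factor 2 before
  the one-form.\<close>

lemma cscale_nth [simp]: "(c *\<^sub>M A) $ i $ j = c * A $ i $ j"
  by (simp add: cscale_def)

lemma ctranspose_nth [simp]: "ctranspose A $ i $ j = cnj (A $ j $ i)"
  by (simp add: ctranspose_def)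

lemma cscale_simps [simp]:
  "1 *\<^sub>M A = A" "0 *\<^sub>M A = 0" "c *\<^sub>M 0 = 0" "(- c) *\<^sub>M A = - (c *\<^sub>M A)" "c *\<^sub>M (- A) = - (c *\<^sub>M A)"
  "c *\<^sub>M d *\<^sub>M A = (c * d) *\<^sub>M A"
  by (simp_all add: vec_eq_iff)

lemma cscale_add_left: "(c + d) *\<^sub>M A = c *\<^sub>M A + d *\<^sub>M A"
  by (simp add: vec_eq_iff algebra_simps)

lemma cscale_add_right: "c *\<^sub>M (A + B) = c *\<^sub>M A + c *\<^sub>M B"
  by (simp add: vec_eq_iff algebra_simps)

lemma cscale_diff_left: "(c - d) *\<^sub>M A = c *\<^sub>M A - d *\<^sub>M A"
  by (simp add: vec_eq_iff algebra_simps)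

lemma cscale_diff_right: "c *\<^sub>M (A - B) = c *\<^sub>M A - c *\<^sub>M B"
  by (simp add: vec_eq_iff algebra_simps)

lemmas cscale_distribs = cscale_add_left cscale_add_right cscale_diff_left cscale_diff_right

lemma cscale_sum_right: "c *\<^sub>M sum f I = (\<Sum>i\<in>I. c *\<^sub>M f i)"
  by (simp add: vec_eq_iff sum_distrib_left)

lemma cscale_of_real: "complex_of_real x *\<^sub>M A = x *\<^sub>R A"
  by (simp add: vec_eq_iff scaleR_conv_of_real[where 'a = complex])

lemma cscale_mult_left [simp]: "(c *\<^sub>M A) ** B = c *\<^sub>M (A ** B)"
  by (simp add: vec_eq_iff matrix_matrix_mult_def sum_distrib_left mult.assoc)

lemma cscale_mult_right [simp]: "A ** (c *\<^sub>M B) = c *\<^sub>M (A ** B)"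
  by (simp add: vec_eq_iff matrix_matrix_mult_def sum_distrib_left mult.left_commute)

lemma ctranspose_mult: "ctranspose (A ** B) = ctranspose B ** ctranspose A"
  by (simp add: vec_eq_iff matrix_matrix_mult_def mult.commute)

lemma ctranspose_simps [simp]:
  "ctranspose (ctranspose A) = A" "ctranspose 0 = 0" "ctranspose (- A) = - ctranspose A"
  "ctranspose (A + B) = ctranspose A + ctranspose B"
  "ctranspose (A - B) = ctranspose A - ctranspose B"
  "ctranspose (c *\<^sub>M A) = cnj c *\<^sub>M ctranspose A" 
  by (simp_all add: vec_eq_iff)

lemma ctranspose_mat_1 [simp]: "ctranspose (mat 1) = mat 1"
  by (simp add: vec_eq_iff mat_def)

lemma ctranspose_sum: "ctranspose (sum f I) = (\<Sum>i\<in>I. ctranspose (f i))"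
  by (simp add: vec_eq_iff)

lemma matrix_mul_minus_left [simp]: "(- A) ** B = - (A ** (B :: complex^'n^'m))"
  by (simp add: vec_eq_iff matrix_matrix_mult_def sum_negf)

lemma matrix_mul_minus_right [simp]: "A ** (- B) = - (A ** (B :: complex^'n^'m))"
  by (simp add: vec_eq_iff matrix_matrix_mult_def sum_negf)

lemma matrix_mul_zero [simp]: "0 ** (B :: complex^'n^'m) = 0" "(A :: complex^'m^'k) ** 0 = 0"
  by (simp_all add: vec_eq_iff matrix_matrix_mult_def)

lemma matrix_mul_distribs:
  fixes A B :: "complex^'n^'m"
  shows "(A + B) ** C = A ** C + B ** C" "D ** (A + B) = D ** A + D ** B"
    "(A - B) ** C = A ** C - B ** C" "D ** (A - B) = D ** A - D ** B"
  by (simp_all add: vec_eq_iff matrix_matrix_mult_def algebra_simps sum.distrib sum_subtractf)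

lemma matrix_mul_sum_left: "(sum f I) ** (B :: complex^'n^'m) = (\<Sum>i\<in>I. f i ** B)"
  by (induction I rule: infinite_finite_induct) (simp_all add: matrix_mul_distribs)

lemma matrix_mul_sum_right: "(B :: complex^'n^'m) ** (sum f I) = (\<Sum>i\<in>I. B ** f i)"
  by (induction I rule: infinite_finite_induct) (simp_all add: matrix_mul_distribs)

lemma matrix_vector_sum_left: "(sum f I) *v (x :: complex^'n) = (\<Sum>i\<in>I. f i *v x)"
  by (induction I rule: infinite_finite_induct) (simp_all add: matrix_vector_mult_add_rdistrib)

lemma sum_nth2 [simp]: "(sum f I) $ i $ j = (\<Sum>k\<in>I. f k $ i $ j)"
  by simp

lemma trace_simps [simp]:
  "trace (0 :: complex^'n^'n) = 0" "trace (- A) = - trace (A :: complex^'n^'n)"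
  "trace (c *\<^sub>M A) = c * trace A" "trace (ctranspose A) = cnj (trace A)"
  by (simp_all add: trace_def sum_negf sum_distrib_left)

lemma trace_ctranspose_mult: "trace (A ** ctranspose A) = of_real (\<Sum>i\<in>UNIV. \<Sum>j\<in>UNIV. (norm (A $ i $ j))\<^sup>2)"
  by (simp add: trace_def matrix_matrix_mult_def complex_norm_square[symmetric])

lemma bounded_bilinear_matrix_mult:
  "bounded_bilinear ((**) :: complex^'n^'m \<Rightarrow> complex^'k^'n \<Rightarrow> complex^'k^'m)"
  unfolding bilinear_conv_bounded_bilinear[symmetric] bilinear_def
  by (auto intro!: linearI simp: matrix_mul_distribs simp flip: cscale_of_real)

lemma bounded_bilinear_matrix_vector_mult:
  "bounded_bilinear ((*v) :: complex^'n^'m \<Rightarrow> _)"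
  unfolding bilinear_conv_bounded_bilinear[symmetric] bilinear_def
  by (auto intro!: linearI simp: vec_eq_iff matrix_vector_mult_def sum.distrib distrib_left distrib_right
      scaleR_sum_right)

lemma bounded_linear_ctranspose: "bounded_linear (ctranspose :: complex^'n^'m \<Rightarrow> _)"
  unfolding linear_conv_bounded_linear[symmetric]
  by (auto intro!: linearI simp flip: cscale_of_real)

lemma bounded_linear_cscale: "bounded_linear (\<lambda>A :: complex^'n^'m. c *\<^sub>M A)"
  unfolding linear_conv_bounded_linear[symmetric]
  by (auto intro!: linearI simp: cscale_distribs mult.commute simp flip: cscale_of_real)

lemma bounded_linear_trace: "bounded_linear (trace :: complex^'n^'n \<Rightarrow> complex)"
  unfolding linear_conv_bounded_linear[symmetric]
  by (auto intro!: linearI simp: trace_add scaleR_conv_of_real[where 'a = complex] simp flip: cscale_of_real)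

lemmas matrix_mult_has_derivative = bounded_bilinear.FDERIV[OF bounded_bilinear_matrix_mult]

lemmas ctranspose_has_derivative = bounded_linear.has_derivative[OF bounded_linear_ctranspose]

lemma unitary_matrix_inv:
  assumes "A \<in> unitary_group" shows "matrix_inv A = ctranspose A"
proof -
  let ?P = "\<lambda>B. A ** B = mat 1 \<and> B ** A = mat 1"
  have *: "?P (matrix_inv A)"
    unfolding matrix_inv_def using assms
    by (intro someI[of ?P "ctranspose A"]) (simp add: unitary_group_def)
  have "matrix_inv A = matrix_inv A ** (A ** ctranspose A)"
    using assms by (simp add: unitary_group_def)
  also have "\<dots> = ctranspose A"
    using * by (simp add: matrix_mul_assoc)
  finally show ?thesis .
qed

lemma hermitian_prod_matrix:
  "hermitian_prod (A *v x) w = hermitian_prod x (ctranspose A *v w)"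
proof -
  have "hermitian_prod (A *v x) w = (\<Sum>i\<in>UNIV. \<Sum>j\<in>UNIV. A $ i $ j * x $ j * cnj (w $ i))"
    by (simp add: hermitian_prod_def matrix_vector_mult_def sum_distrib_right)
  also have "\<dots> = (\<Sum>j\<in>UNIV. \<Sum>i\<in>UNIV. A $ i $ j * x $ j * cnj (w $ i))"
    by (rule sum.swap)
  also have "\<dots> = hermitian_prod x (ctranspose A *v w)"
    by (simp add: hermitian_prod_def matrix_vector_mult_def sum_distrib_left mult_ac)
  finally show ?thesis .
qed

section \<open>The block columns of a unitary polynomial loop\<close>

text \<open>The isometry of C^n onto the coordinates of slot \<open>a\<close>. Writing
  \<open>block_col\<close> as a sum of products with these keeps it visibly linear in
  \<open>T\<close>, so derivatives and index shifts pass through it.\<close>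

definition inclusion :: "'r::finite \<Rightarrow> complex^'n^('r \<times> 'n)" where
  "inclusion a = (\<chi> p j. if p = (a, j) then 1 else 0)"

text \<open>The coefficients of degree \<open>0, \<dots>, r - 1\<close> of \<open>\<zeta>\<^sup>m T(\<zeta>)\<close>, stacked into one matrix.\<close>

definition block_col :: "('r::finite \<Rightarrow> nat) \<Rightarrow> (int \<Rightarrow> complex^'n^'n) \<Rightarrow> int \<Rightarrow> complex^'n^('r \<times> 'n)" where
  "block_col deg T m = (\<Sum>a\<in>UNIV. inclusion a ** T (int (deg a) - m))"

text \<open>When \<open>T\<close> vanishes at negative indices, columns with m >= r are zero, so
  this finite sum stands for the one over all m >= 0.\<close>

definition block_proj ::
  "('r::finite \<Rightarrow> nat) \<Rightarrow> nat \<Rightarrow> (int \<Rightarrow> complex^'n^'n) \<Rightarrow> complex^('r \<times> 'n)^('r \<times> 'n)" where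
  "block_proj deg r T = (\<Sum>m=0..int r - 1. block_col deg T m ** ctranspose (block_col deg T m))"

lemma block_col_nth: "block_col deg T m $ p $ j = T (int (deg (fst p)) - m) $ snd p $ j"
proof (cases p)
  case (Pair a i)
  have "block_col deg T m $ (a, i) $ j = (\<Sum>b\<in>UNIV. \<Sum>l\<in>UNIV.
      (if b = a then if l = i then T (int (deg b) - m) $ l $ j else 0 else 0))"
    unfolding block_col_def inclusion_def sum_component matrix_matrix_mult_def
    by (auto intro!: sum.cong)
  also have "\<dots> = (\<Sum>b\<in>UNIV. if b = a then T (int (deg b) - m) $ i $ j else 0)"
    by (intro sum.cong) auto
  finally show ?thesis
    by (simp add: Pair)
qed

text \<open>The last two assumptions are \<Psi>^* \<Psi> = 1 and \<Psi> \<Psi>^* = 1, read in degree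
  m. The first yields inner products of block columns, the second the resolution of the
  identity.\<close>

locale unitary_polynomial =
  fixes T :: "int \<Rightarrow> complex^'n^'n" and r :: nat and deg :: "'r::finite \<Rightarrow> nat"
  assumes deg: "bij_betw deg UNIV {..<r}"
    and supp: "k \<notin> {0..int r} \<Longrightarrow> T k = 0"
    and left_inverse: "(\<Sum>k=0..int r. ctranspose (T k) ** T (k + m)) = (if m = 0 then mat 1 else 0)"
    and right_inverse: "(\<Sum>k=0..int r. T (k + m) ** ctranspose (T k)) = (if m = 0 then mat 1 else 0)"
begin

abbreviation "block \<equiv> block_col deg T"

abbreviation "proj \<equiv> block_proj deg r T"

lemma sum_deg: "(\<Sum>a\<in>UNIV. f (int (deg a))) = (\<Sum>a=0..int r - 1. f a)"
proof -
  have "bij_betw int {..<r} {0..int r - 1}"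
    by (auto simp: bij_betw_def image_iff intro!: inj_onI bexI[of _ "nat _"])
  from bij_betw_trans[OF deg this] show ?thesis
    by (subst sum.reindex_bij_betw[symmetric]) (auto simp: comp_def)
qed

lemma deg_less: "deg a < r"
  using deg by (auto simp: bij_betw_def)

lemma gram: "ctranspose (block m) ** block m' = (\<Sum>a=0..int r - 1. ctranspose (T (a - m)) ** T (a - m'))"
proof -
  have "(ctranspose (block m) ** block m') $ i $ j =
      (\<Sum>a=0..int r - 1. ctranspose (T (a - m)) ** T (a - m')) $ i $ j" for i j
  proof -
    have "(ctranspose (block m) ** block m') $ i $ j = (\<Sum>a\<in>UNIV. \<Sum>l\<in>UNIV.
        cnj (T (int (deg a) - m) $ l $ i) * T (int (deg a) - m') $ l $ j)"
      by (simp add: matrix_matrix_mult_def block_col_nth sum.cartesian_product case_prod_unfold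
          flip: UNIV_Times_UNIV)
    also have "\<dots> = (\<Sum>a=0..int r - 1. \<Sum>l\<in>UNIV. cnj (T (a - m) $ l $ i) * T (a - m') $ l $ j)"
      by (rule sum_deg)
    finally show ?thesis
      by (simp add: matrix_matrix_mult_def)
  qed
  then show ?thesis
    by (simp add: vec_eq_iff)
qed

text \<open>Truncation to degrees 0, ..., r - 1 is harmless if every degree where both coefficients
  can be nonzero lies in this window; then \<open>left_inverse\<close> applies. The premise says
  this, with k = a - m.\<close>

lemma gram_eq:
  assumes "\<And>k. 0 \<le> k \<Longrightarrow> k \<le> int r \<Longrightarrow> 0 \<le> k + m - m' \<Longrightarrow> k + m - m' \<le> int r \<Longrightarrow> k + m \<in> {0..int r - 1}"
  shows "ctranspose (block m) ** block m' = (if m = m' then mat 1 else 0)"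
proof -
  have "ctranspose (block m) ** block m' = (\<Sum>a\<in>{0..int r - 1} \<inter> {m..m + int r}. ctranspose (T (a - m)) ** T (a - m'))"
    unfolding gram by (intro sum.mono_neutral_right) (auto simp: supp)
  also have "\<dots> = (\<Sum>a=m..m + int r. ctranspose (T (a - m)) ** T (a - m'))"
  proof (intro sum.mono_neutral_left ballI)
    fix a assume a: "a \<in> {m..m + int r} - {0..int r - 1} \<inter> {m..m + int r}"
    then have "T (a - m') = 0"
      using assms[of "a - m"] by (intro supp) auto
    then show "ctranspose (T (a - m)) ** T (a - m') = 0"
      by simp
  qed auto
  also have "\<dots> = (\<Sum>k=0..int r. ctranspose (T k) ** T (k + (m - m')))"
    by (rule sum.reindex_bij_witness[of _ "\<lambda>k. k + m" "\<lambda>a. a - m"]) (auto simp: algebra_simps)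
  finally show ?thesis
    by (simp add: left_inverse)
qed

text \<open>A nonzero term needs k >= 0 in column m and k + m - m' <= r in column m', so its degree
  k + m lies between m >= 0 and r + m' < r.\<close>

lemma gram_orthogonal:
  assumes "m \<ge> 0" "m' < 0"
  shows "ctranspose (block m) ** block m' = 0" "ctranspose (block m') ** block m = 0"
proof -
  show *: "ctranspose (block m) ** block m' = 0"
    using assms by (subst gram_eq) auto
  show "ctranspose (block m') ** block m = 0"
    using arg_cong[OF *, of ctranspose] by (simp add: ctranspose_mult)
qed

text \<open>Here the sum runs over shifts instead of degrees, so nothing is truncated and
  \<open>right_inverse\<close> applies entry by entry. In a row of degree d the nonzero terms have d
  - r <= m <= d, which fits into the range because 0 <= d < r.\<close>

lemma block_resolution: "(\<Sum>m=-int r..int r - 1. block m ** ctranspose (block m)) = mat 1"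
proof -
  have "(\<Sum>m=-int r..int r - 1. block m ** ctranspose (block m)) $ p $ q = mat 1 $ p $ q" for p q
  proof -
    obtain a i b j where pq: "p = (a, i)" "q = (b, j)"
      by (cases p, cases q)
    let ?a = "int (deg a)" and ?b = "int (deg b)"
    have "(\<Sum>m=-int r..int r - 1. block m ** ctranspose (block m)) $ p $ q =
        (\<Sum>m=-int r..int r - 1. T (?a - m) ** ctranspose (T (?b - m))) $ i $ j"
      by (simp add: pq matrix_matrix_mult_def block_col_nth)
    also have "(\<Sum>m=-int r..int r - 1. T (?a - m) ** ctranspose (T (?b - m))) =
        (\<Sum>m=?b - int r..?b. T (?a - m) ** ctranspose (T (?b - m)))"
      using deg_less[of b] by (intro sum.mono_neutral_right) (auto simp: supp)
    also have "\<dots> = (\<Sum>k=0..int r. T (k + (?a - ?b)) ** ctranspose (T k))"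
      by (rule sum.reindex_bij_witness[of _ "\<lambda>k. ?b - k" "\<lambda>k. ?b - k"]) (auto simp: algebra_simps)
    also have "\<dots> = (if a = b then mat 1 else 0)"
      using deg by (auto simp: right_inverse bij_betw_def inj_on_eq_iff)
    finally show ?thesis
      by (auto simp: pq mat_def)
  qed
  then show ?thesis
    by (simp add: vec_eq_iff)
qed

text \<open>\<open>ctranspose (block m) *v v\<close> is the coefficient of degree m of \<Psi>^* v,
  so these are the polynomials that \<Psi>^* maps into the Hardy space; degrees below -r cannot
  occur.\<close>

definition kern :: "(complex^('r \<times> 'n)) set" where
  "kern = {v. \<forall>m\<in>{-int r..-1}. ctranspose (block m) *v v = 0}"

lemma proj_complement: "mat 1 - proj = (\<Sum>m=-int r..-1. block m ** ctranspose (block m))"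
proof -
  have "{-int r..int r - 1} = {-int r..-1} \<union> {0..int r - 1}"
    by auto
  then have "mat 1 = (\<Sum>m=-int r..-1. block m ** ctranspose (block m)) + proj"
    unfolding block_resolution[symmetric] block_proj_def by (subst sum.union_disjoint[symmetric]) auto
  then show ?thesis
    by simp
qed

lemma kern_iff: "v \<in> kern \<longleftrightarrow> proj *v v = v"
proof
  assume v: "v \<in> kern"
  have "v - proj *v v = (mat 1 - proj) *v v"
    by (simp add: matrix_vector_mult_diff_rdistrib)
  also have "\<dots> = (\<Sum>m=-int r..-1. block m *v (ctranspose (block m) *v v))"
    unfolding proj_complement matrix_vector_sum_left by (simp add: matrix_vector_mul_assoc)
  also have "\<dots> = 0"
    using v by (simp add: kern_def)
  finally show "proj *v v = v"
    by simp
next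
  assume v: "proj *v v = v"
  have "ctranspose (block m) ** proj = 0" if "m \<in> {-int r..-1}" for m
    using that unfolding block_proj_def matrix_mul_sum_right
    by (intro sum.neutral) (auto simp: matrix_mul_assoc gram_orthogonal)
  then have "ctranspose (block m) *v (proj *v v) = 0" if "m \<in> {-int r..-1}" for m
    using that by (simp add: matrix_vector_mul_assoc)
  then show "v \<in> kern"
    by (simp add: kern_def v)
qed

lemma ctranspose_proj: "ctranspose proj = proj"
  by (simp add: block_proj_def ctranspose_sum ctranspose_mult)

text \<open>The columns with m >= 0 need not be orthonormal among themselves, so idempotence does
  not come termwise. It comes from (1 - \<pi>) \<pi> = 0, where every product pairs a negative index
  with a nonnegative one.\<close>

lemma proj_idem: "proj ** proj = proj"
proof -
  have "block m ** ctranspose (block m) ** (block m' ** ctranspose (block m')) = 0"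
    if "m \<in> {-int r..-1}" "m' \<in> {0..int r - 1}" for m m'
  proof -
    have "ctranspose (block m) ** block m' = 0"
      using that by (simp add: gram_orthogonal)
    then show ?thesis
      by (metis matrix_mul_assoc matrix_mul_zero)
  qed
  then have "(mat 1 - proj) ** proj = 0"
    unfolding proj_complement by (simp add: block_proj_def matrix_mul_sum_left matrix_mul_sum_right)
  then show ?thesis
    by (simp add: matrix_mul_distribs)
qed

text \<open>In degrees 0, ..., r - 1 the unshifted loop loses just its top coefficient.\<close>

lemma gram_0: "ctranspose (block 0) ** block 0 = mat 1 - ctranspose (T (int r)) ** T (int r)"
proof -
  have "{0..int r} = insert (int r) {0..int r - 1}"
    by auto
  then show ?thesis
    using left_inverse[of 0] by (simp add: gram algebra_simps)
qed

text \<open>Division by \<zeta> moves just the lowest coefficient out of the window.\<close>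

lemma gram_minus_1: "ctranspose (block (-1)) ** block (-1) = mat 1 - ctranspose (T 0) ** T 0"
proof -
  have "{0..int r} = insert 0 {1..int r}"
    by auto
  moreover have "(\<Sum>a=0..int r - 1. ctranspose (T (a + 1)) ** T (a + 1)) = (\<Sum>a=1..int r. ctranspose (T a) ** T a)"
    by (rule sum.reindex_bij_witness[of _ "\<lambda>k. k - 1" "\<lambda>k. k + 1"]) auto
  ultimately show ?thesis
    using left_inverse[of 0] by (simp add: gram algebra_simps)
qed

text \<open>\<open>S\<close> kills the complement of X and maps X into it. The hypotheses cancel the
  defects in \<open>gram_0\<close> and \<open>gram_minus_1\<close>: the first Gram matrix acts as
  the identity on the range of the adjoint of \<open>A\<close>, the second on the range of
  \<open>A\<close>.\<close>

lemma trace_second_fundamental_form: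
  fixes A :: "complex^'n^'n"
  assumes "T 0 ** A = 0" "T (int r) ** ctranspose A = 0"
  defines "S \<equiv> - (block (-1) ** A ** ctranspose (block 0))"
  shows "S ** S = 0" "trace (S ** ctranspose S) = trace (A ** ctranspose A)"
proof -
  have "S ** S = block (-1) ** A ** (ctranspose (block 0) ** block (-1)) ** A ** ctranspose (block 0)"
    by (simp add: S_def matrix_mul_assoc)
  then show "S ** S = 0"
    by (simp add: gram_orthogonal)
  have "trace (S ** ctranspose S) =
      trace (block (-1) ** (A ** (ctranspose (block 0) ** block 0) ** ctranspose A ** ctranspose (block (-1))))"
    by (simp add: S_def ctranspose_mult matrix_mul_assoc)
  also have "\<dots> = trace (A ** ((ctranspose (block 0) ** block 0) ** ctranspose A) ** (ctranspose (block (-1)) ** block (-1)))"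
    by (subst trace_mul_sym) (simp add: matrix_mul_assoc)
  also have "(ctranspose (block 0) ** block 0) ** ctranspose A = ctranspose A"
    using assms(2) by (simp add: gram_0 matrix_mul_distribs flip: matrix_mul_assoc)
  also have "trace (A ** ctranspose A ** (ctranspose (block (-1)) ** block (-1))) =
      trace (((ctranspose (block (-1)) ** block (-1)) ** A) ** ctranspose A)"
    by (subst trace_mul_sym) (simp add: matrix_mul_assoc)
  also have "(ctranspose (block (-1)) ** block (-1)) ** A = A"
    using assms(1) by (simp add: gram_minus_1 matrix_mul_distribs flip: matrix_mul_assoc)
  finally show "trace (S ** ctranspose S) = trace (A ** ctranspose A)" .
qed

end

section \<open>The derivative of the projection\<close>

lemma has_derivative_block_col:
  assumes "\<And>k. ((\<lambda>z. T z k) has_derivative T' k) (at z)"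
  shows "((\<lambda>z. block_col deg (T z) m) has_derivative (\<lambda>v. block_col deg (\<lambda>k. T' k v) m)) (at z)"
  unfolding block_col_def
  by (intro has_derivative_sum)
    (auto intro!: bounded_linear.has_derivative[OF bounded_bilinear.bounded_linear_right[OF bounded_bilinear_matrix_mult]] assms)

text \<open>With k = \<open>deg a\<close> - m, raising the coefficient index by one lowers m by one;
  this turns the equation for coefficients into one for whole columns.\<close>

lemma block_col_extended_solution:
  "block_col deg (\<lambda>k. v *\<^sub>M ((T k - T (k + 1)) ** A) - cnj v *\<^sub>M ((T k - T (k - 1)) ** ctranspose A)) m =
    v *\<^sub>M ((block_col deg T m - block_col deg T (m - 1)) ** A) -
    cnj v *\<^sub>M ((block_col deg T m - block_col deg T (m + 1)) ** ctranspose A)"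
  by (simp add: block_col_def matrix_mul_distribs cscale_distribs cscale_sum_right matrix_mul_sum_left
      sum.distrib sum_subtractf algebra_simps flip: matrix_mul_assoc)

lemma has_derivative_block_proj:
  fixes T :: "complex \<Rightarrow> int \<Rightarrow> complex^'n^'n" and deg :: "'r::finite \<Rightarrow> nat"
  assumes der: "\<And>k. ((\<lambda>z. T z k) has_derivative
      (\<lambda>v. v *\<^sub>M ((T z k - T z (k + 1)) ** A) - cnj v *\<^sub>M ((T z k - T z (k - 1)) ** ctranspose A))) (at z)"
    and supp: "\<And>k. k < 0 \<Longrightarrow> T z k = 0" and deg: "\<And>a. deg a < r"
  defines "S \<equiv> - (block_col deg (T z) (-1) ** A ** ctranspose (block_col deg (T z) 0))"
  shows "((\<lambda>z. block_proj deg r (T z)) has_derivative (\<lambda>v. v *\<^sub>M S + cnj v *\<^sub>M ctranspose S)) (at z)"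
proof -
  define C where "C = block_col deg (T z)"
  \<comment> \<open>In the v-part of the derivative of C_m C_m^* the terms C_m A C_m^* cancel, and
    what remains is \<open>P (m + 1) - P m\<close>.\<close>
  define P where "P m = C (m - 1) ** A ** ctranspose (C m)" for m
  \<comment> \<open>This removes the upper boundary term of the telescoping sum; only
    \<open>- P 0\<close>, which is \<open>S\<close>, is left.\<close>
  have C_r: "C (int r) = 0"
    unfolding C_def block_col_def using deg by (intro sum.neutral) (auto simp: supp)
  have telescope: "(\<Sum>m=0..int n - 1. P (m + 1) - P m) = P (int n) - P 0" for n
  proof (induction n)
    case (Suc n)
    have "{0..int (Suc n) - 1} = insert (int n) {0..int n - 1}"
      by auto
    then show ?case
      using Suc by (simp add: add.commute)
  qed simp
  have "((\<lambda>z. block_col deg (T z) m) has_derivative (\<lambda>v. v *\<^sub>M ((C m - C (m - 1)) ** A) -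
      cnj v *\<^sub>M ((C m - C (m + 1)) ** ctranspose A))) (at z)" for m
  proof -
    have "((\<lambda>z. block_col deg (T z) m) has_derivative (\<lambda>v. block_col deg
        (\<lambda>k. v *\<^sub>M ((T z k - T z (k + 1)) ** A) - cnj v *\<^sub>M ((T z k - T z (k - 1)) ** ctranspose A)) m)) (at z)"
      by (rule has_derivative_block_col) (rule der)
    then show ?thesis
      by (simp add: C_def block_col_extended_solution)
  qed
  from matrix_mult_has_derivative[OF this ctranspose_has_derivative[OF this]]
  have "((\<lambda>z. block_proj deg r (T z)) has_derivative (\<lambda>v. \<Sum>m=0..int r - 1.
      C m ** ctranspose (v *\<^sub>M ((C m - C (m - 1)) ** A) - cnj v *\<^sub>M ((C m - C (m + 1)) ** ctranspose A)) +
      (v *\<^sub>M ((C m - C (m - 1)) ** A) - cnj v *\<^sub>M ((C m - C (m + 1)) ** ctranspose A)) ** ctranspose (C m))) (at z)"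
    unfolding block_proj_def by (intro has_derivative_sum) (simp add: C_def)
  moreover have "(\<Sum>m=0..int r - 1.
      C m ** ctranspose (v *\<^sub>M ((C m - C (m - 1)) ** A) - cnj v *\<^sub>M ((C m - C (m + 1)) ** ctranspose A)) +
      (v *\<^sub>M ((C m - C (m - 1)) ** A) - cnj v *\<^sub>M ((C m - C (m + 1)) ** ctranspose A)) ** ctranspose (C m)) =
      v *\<^sub>M S + cnj v *\<^sub>M ctranspose S" for v
  proof -
    have "(\<Sum>m=0..int r - 1.
        C m ** ctranspose (v *\<^sub>M ((C m - C (m - 1)) ** A) - cnj v *\<^sub>M ((C m - C (m + 1)) ** ctranspose A)) +
        (v *\<^sub>M ((C m - C (m - 1)) ** A) - cnj v *\<^sub>M ((C m - C (m + 1)) ** ctranspose A)) ** ctranspose (C m)) =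
        (\<Sum>m=0..int r - 1. v *\<^sub>M (P (m + 1) - P m) + cnj v *\<^sub>M ctranspose (P (m + 1) - P m))"
      by (intro sum.cong refl)
        (simp add: P_def ctranspose_mult matrix_mul_distribs cscale_distribs matrix_mul_assoc algebra_simps)
    also have "\<dots> = v *\<^sub>M (P (int r) - P 0) + cnj v *\<^sub>M ctranspose (P (int r) - P 0)"
      unfolding sum.distrib telescope[symmetric] by (simp only: cscale_sum_right ctranspose_sum)
    also have "P (int r) - P 0 = S"
      by (simp add: P_def C_r S_def flip: C_def)
    finally show ?thesis .
  qed
  ultimately show ?thesis
    by simp
qed

section \<open>Orthogonal projections and the Cartan embedding\<close>

lemma hermitian_prod_self: "hermitian_prod x x = 0 \<longleftrightarrow> x = 0"
proof -
  have "hermitian_prod x x = of_real (\<Sum>i\<in>UNIV. (norm (x $ i))\<^sup>2)"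
    by (simp add: hermitian_prod_def complex_norm_square[symmetric])
  then show ?thesis
    by (simp add: sum_nonneg_eq_0_iff vec_eq_iff del: of_real_sum)
qed

locale hermitian_projection =
  fixes P :: "complex^'m^'m"
  assumes idem: "P ** P = P" and self_adjoint: "ctranspose P = P"
begin

lemma proj_proj [simp]: "P *v (P *v x) = P *v x"
  by (simp add: matrix_vector_mul_assoc idem)

lemma hermitian_compl_range: "hermitian_compl {v. P *v v = v} = {v. P *v v = 0}"
proof (intro set_eqI iffI)
  fix v assume v: "v \<in> hermitian_compl {v. P *v v = v}"
  have "hermitian_prod (P *v v) (P *v v) = hermitian_prod v (P *v v)"
    by (simp add: hermitian_prod_matrix self_adjoint)
  also have "\<dots> = 0"
    using v by (simp add: hermitian_compl_def)
  finally show "v \<in> {v. P *v v = 0}"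
    by (simp add: hermitian_prod_self)
next
  fix v assume v: "v \<in> {v. P *v v = 0}"
  have "hermitian_prod v w = 0" if "P *v w = w" for w
  proof -
    have "hermitian_prod v w = hermitian_prod (P *v v) w"
      by (simp add: hermitian_prod_matrix self_adjoint that)
    then show ?thesis
      using v by (simp add: hermitian_prod_def)
  qed
  then show "v \<in> hermitian_compl {v. P *v v = v}"
    by (simp add: hermitian_compl_def)
qed

lemma orth_proj_range: "orth_proj {v. P *v v = v} = P"
  unfolding orth_proj_def
proof (rule the_equality)
  show "\<forall>v. P *v v \<in> {v. P *v v = v} \<and> v - P *v v \<in> hermitian_compl {v. P *v v = v}"
    unfolding hermitian_compl_range by (simp add: matrix_vector_mult_diff_distrib)
next
  fix R assume R: "\<forall>v. R *v v \<in> {v. P *v v = v} \<and> v - R *v v \<in> hermitian_compl {v. P *v v = v}"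
  have "R *v v = P *v v" for v
  proof -
    have "P *v (R *v v) = R *v v" "P *v (v - R *v v) = 0"
      using R unfolding hermitian_compl_range by auto
    then show ?thesis
      by (simp add: matrix_vector_mult_diff_distrib)
  qed
  then show "R = P"
    by (simp add: matrix_eq)
qed

lemma complement: "hermitian_projection (mat 1 - P)"
  by unfold_locales (simp_all add: matrix_mul_distribs idem self_adjoint)

lemma cartan_embedding_range: "cartan_embedding {v. P *v v = v} = 2 *\<^sub>M P - mat 1"
proof -
  have "hermitian_compl {v. P *v v = v} = {v. (mat 1 - P) *v v = v}"
    unfolding hermitian_compl_range by (auto simp: matrix_vector_mult_diff_rdistrib)
  then show ?thesis
    unfolding cartan_embedding_def
    by (simp add: orth_proj_range hermitian_projection.orth_proj_range[OF complement])
      (simp add: vec_eq_iff)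
qed

lemma cartan_unitary: "2 *\<^sub>M P - mat 1 \<in> unitary_group"
  by (simp add: unitary_group_def self_adjoint matrix_mul_distribs cscale_distribs idem)
    (simp add: vec_eq_iff)

end

section \<open>The invariant metric\<close>

text \<open>Conjugation by \<open>U\<close> leaves the trace alone. So the metric on the
  Grassmannian can be computed from the derivative of the Cartan embedding without translating back
  to the identity.\<close>

lemma h_metric_unitary:
  assumes "U \<in> unitary_group"
  shows "h_metric U a b = Re (trace (a ** ctranspose b)) / 8"
proof -
  have "trace ((ctranspose U ** a) ** ctranspose (ctranspose U ** b)) =
      trace (ctranspose U ** ((a ** ctranspose b) ** U))"
    by (simp add: ctranspose_mult matrix_mul_assoc)
  also have "\<dots> = trace ((a ** ctranspose b) ** (U ** ctranspose U))"
    by (subst trace_mul_sym) (simp add: matrix_mul_assoc)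
  finally show ?thesis
    using assms unfolding h_metric_def h_lie_def unitary_matrix_inv[OF assms]
    by (simp add: unitary_group_def)
qed

lemma h_metric_self:
  assumes "U \<in> unitary_group"
  shows "h_metric U a a = 0 \<longleftrightarrow> a = 0"
  by (auto simp: h_metric_unitary[OF assms] trace_ctranspose_mult sum_nonneg_eq_0_iff sum_nonneg vec_eq_iff
      simp del: of_real_sum)

text \<open>Products of equal type contribute tr (A A) and its conjugate, which vanish; only the
  mixed ones survive. The sign \<open>e\<close> covers a Hermitian one-form (e = 1, the derivative
  of a projection) and a skew-Hermitian one (e = -1, from \<psi>).\<close>

lemma conformal_trace:
  fixes A :: "complex^'n^'n"
  assumes "trace (A ** A) = 0" "e = 1 \<or> e = -1"
  shows "Re (trace ((u *\<^sub>M A + (e * cnj u) *\<^sub>M ctranspose A) ** ctranspose (v *\<^sub>M A + (e * cnj v) *\<^sub>M ctranspose A))) =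
    2 * Re (u * cnj v) * Re (trace (A ** ctranspose A))"
proof -
  have *: "trace (ctranspose A ** ctranspose A) = 0"
    using arg_cong[OF assms(1), of cnj] trace_simps(4)[of "A ** A"] by (simp add: ctranspose_mult)
  have **: "Im (trace (A ** ctranspose A)) = 0"
    by (simp add: trace_ctranspose_mult del: of_real_sum)
  show ?thesis
    using assms(2) by (auto simp: matrix_mul_distribs cscale_distribs trace_add assms(1) * ** 
        trace_mul_sym[of "ctranspose A" A] algebra_simps)
qed

text \<open>The metric is definite, so the null vectors of the pullback form the kernel of the
  differential. Both immersion conditions thereby depend on the pullback metric alone.\<close>

lemma sphere_immersion_iff:
  assumes "\<And>p. f p \<in> unitary_group"
    and "\<And>c z. c \<in> sphere_charts \<Longrightarrow> (\<lambda>x. f (c x)) differentiable (at z)"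
  shows "sphere_immersion f \<longleftrightarrow>
    (\<forall>c\<in>sphere_charts. \<forall>z u. pullback_metric f c z u u = 0 \<longrightarrow> u = 0)"
proof -
  have "(\<exists>D. ((\<lambda>x. f (c x)) has_derivative D) (at z) \<and> inj D) \<longleftrightarrow>
      (\<forall>u. pullback_metric f c z u u = 0 \<longrightarrow> u = 0)" if "c \<in> sphere_charts" for c z
  proof -
    let ?D = "frechet_derivative (\<lambda>x. f (c x)) (at z)"
    have D: "((\<lambda>x. f (c x)) has_derivative ?D) (at z)"
      using assms(2)[OF that] by (simp add: frechet_derivative_works)
    then have "(\<exists>D. ((\<lambda>x. f (c x)) has_derivative D) (at z) \<and> inj D) \<longleftrightarrow> inj ?D"
      using has_derivative_unique by blast
    also have "\<dots> \<longleftrightarrow> (\<forall>u. ?D u = 0 \<longrightarrow> u = 0)"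
      using has_derivative_linear[OF D] by (rule linear_injective_0)
    finally show ?thesis
      by (simp add: pullback_metric_def h_metric_self assms(1))
  qed
  then show ?thesis
    by (simp add: sphere_immersion_def)
qed

section \<open>Fourier series on the circle\<close>

lemma sphere_cis: "z \<in> sphere 0 1 \<longleftrightarrow> (\<exists>t\<in>{0..2 * pi}. z = cis t)"
proof
  assume z: "z \<in> sphere 0 1"
  then have "z = cis (Arg2pi z)"
    using Arg2pi_eq[of z] by (simp add: cis_conv_exp)
  then show "\<exists>t\<in>{0..2 * pi}. z = cis t"
    using Arg2pi_ge_0[of z] Arg2pi_lt_2pi[of z] by force
qed auto

lemma continuous_on_circle:
  assumes "continuous_on (sphere 0 1) f"
  shows "continuous_on S (\<lambda>t. f (cis t))"
  by (rule continuous_on_compose2[OF assms]) (auto intro!: continuous_intros)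

text \<open>Preimages of closed sets on the circle are images under \<open>cis\<close> of compact
  sets of angles, hence closed. Loops are given as smooth functions of the angle, so the passage
  back to the circle is needed.\<close>

lemma continuous_on_circle_iff:
  fixes f :: "complex \<Rightarrow> 'b::topological_space"
  shows "continuous_on (sphere 0 1) f \<longleftrightarrow> continuous_on {0..2 * pi} (\<lambda>t. f (cis t))"
proof (intro iffI continuous_on_circle)
  assume f: "continuous_on {0..2 * pi} (\<lambda>t. f (cis t))"
  show "continuous_on (sphere 0 1) f"
  proof (subst continuous_on_closed_vimage, simp, intro allI impI)
    fix B :: "'b set" assume "closed B"
    then have "closed ((\<lambda>t. f (cis t)) -` B \<inter> {0..2 * pi})"
      using f continuous_on_closed_vimage[of "{0..2 * pi}" "\<lambda>t. f (cis t)"] by blast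
    then have "compact (((\<lambda>t. f (cis t)) -` B \<inter> {0..2 * pi}) \<inter> {0..2 * pi})"
      by (intro closed_Int_compact) auto
    then have "compact (cis ` (((\<lambda>t. f (cis t)) -` B \<inter> {0..2 * pi}) \<inter> {0..2 * pi}))"
      by (intro compact_continuous_image continuous_intros)
    moreover have "cis ` (((\<lambda>t. f (cis t)) -` B \<inter> {0..2 * pi}) \<inter> {0..2 * pi}) = f -` B \<inter> sphere 0 1"
      using sphere_cis by fastforce
    ultimately show "closed (f -` B \<inter> sphere 0 1)"
      by (simp add: compact_imp_closed)
  qed
qed

lemma integrable_circle:
  fixes f :: "complex \<Rightarrow> 'a::euclidean_space"
  assumes "continuous_on (sphere 0 1) f"
  shows "integrable circle_measure (\<lambda>t. f (cis t))"
  by (intro continuous_imp_integrable_real continuous_on_circle assms)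

lemma integral_cis:
  "(\<integral>t. cis (of_int k * t) \<partial>circle_measure) = (if k = 0 then 2 * pi else 0)"
proof -
  have "integrable circle_measure (\<lambda>t. cis (of_int k * t))"
    by (intro continuous_imp_integrable_real continuous_intros)
  then have *: "(\<integral>t. cis (of_int k * t) \<partial>circle_measure) = integral {0..2 * pi} (\<lambda>t. cis (of_int k * t))"
    by (rule lebesgue_integral_eq_integral) auto
  show ?thesis
  proof (cases "k = 0")
    case False
    have "((\<lambda>t. cis (of_int k * t)) has_integral
        cis (of_int k * (2 * pi)) / (\<i> * of_int k) - cis (of_int k * 0) / (\<i> * of_int k)) {0..2 * pi}"
      using False
      by (intro fundamental_theorem_of_calculus)
        (auto intro!: derivative_eq_intros simp: has_vector_derivative_def scaleR_conv_of_real field_simps)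
    then have "integral {0..2 * pi} (\<lambda>t. cis (of_int k * t)) = 
        cis (of_int k * (2 * pi)) / (\<i> * of_int k) - cis (of_int k * 0) / (\<i> * of_int k)"
      by (rule integral_unique)
    also have "cis (of_int k * (2 * pi)) = 1"
      using cis_multiple_2pi[of "of_int k"] by (simp add: mult.commute)
    finally show ?thesis
      using False * by simp
  qed (unfold *, simp add: scaleR_conv_of_real)
qed

text \<open>This is 2 pi times the Fourier coefficient of index -k. With this sign, multiplication
  by a power of z raises the index by the exponent.\<close>

definition circle_coeff :: "(complex \<Rightarrow> complex) \<Rightarrow> int \<Rightarrow> complex" where
  "circle_coeff f k = (\<integral>t. cis t powi k * f (cis t) \<partial>circle_measure)"

lemma continuous_on_powi: "continuous_on (sphere 0 (1::real)) (\<lambda>z::complex. z powi k)"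
  by (intro continuous_on_power_int continuous_intros) auto

lemma integrable_coeff:
  assumes "continuous_on (sphere 0 1) f"
  shows "integrable circle_measure (\<lambda>t. cis t powi k * f (cis t) :: complex)"
  by (rule integrable_circle) (intro continuous_intros continuous_on_powi assms)

lemma circle_coeff_add:
  assumes "continuous_on (sphere 0 1) f" "continuous_on (sphere 0 1) g"
  shows "circle_coeff (\<lambda>z. f z + g z) k = circle_coeff f k + circle_coeff g k"
  using assms by (simp add: circle_coeff_def distrib_left integrable_coeff)

lemma circle_coeff_diff:
  assumes "continuous_on (sphere 0 1) f" "continuous_on (sphere 0 1) g"
  shows "circle_coeff (\<lambda>z. f z - g z) k = circle_coeff f k - circle_coeff g k"
  using assms by (simp add: circle_coeff_def right_diff_distrib integrable_coeff)

lemma circle_coeff_cmult: "circle_coeff (\<lambda>z. c * f z) k = c * circle_coeff f k"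
  by (simp add: circle_coeff_def mult.left_commute[of _ c])

lemma circle_coeff_cong:
  assumes "\<And>z. z \<in> sphere 0 1 \<Longrightarrow> f z = g z"
  shows "circle_coeff f k = circle_coeff g k"
  unfolding circle_coeff_def using assms by (intro Bochner_Integration.integral_cong) auto

lemma circle_coeff_shift: "circle_coeff (\<lambda>z. z powi j * f z) k = circle_coeff f (k + j)"
  unfolding circle_coeff_def
  by (intro Bochner_Integration.integral_cong refl) (simp add: power_int_add mult.assoc)

lemma circle_coeff_laurent:
  fixes c :: "int \<Rightarrow> complex"
  assumes "finite K"
  shows "circle_coeff (\<lambda>z. \<Sum>k\<in>K. c k * z powi k) j = (if - j \<in> K then 2 * pi * c (- j) else 0)"
proof -
  have "circle_coeff (\<lambda>z. \<Sum>k\<in>K. c k * z powi k) j =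
      (\<integral>t. (\<Sum>k\<in>K. c k * cis (of_int (j + k) * t)) \<partial>circle_measure)"
    unfolding circle_coeff_def
    by (intro Bochner_Integration.integral_cong refl)
      (simp add: sum_distrib_left cis_power_int cis_mult mult.left_commute[of _ "c _"] algebra_simps)
  also have "\<dots> = (\<Sum>k\<in>K. c k * (\<integral>t. cis (of_int (j + k) * t) \<partial>circle_measure))"
    by (subst Bochner_Integration.integral_sum)
      (auto intro!: continuous_imp_integrable_real continuous_intros)
  also have "\<dots> = (\<Sum>k\<in>K. if k = - j then 2 * pi * c k else 0)"
    unfolding integral_cis by (intro sum.cong) auto
  also have "\<dots> = (if - j \<in> K then 2 * pi * c (- j) else 0)"
    using assms by (simp add: sum.delta)
  finally show ?thesis .
qed

lemma laurent_unique:
  fixes c :: "int \<Rightarrow> complex"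
  assumes "finite K" "\<And>z. z \<in> sphere 0 1 \<Longrightarrow> (\<Sum>k\<in>K. c k * z powi k) = 0" "k \<in> K"
  shows "c k = 0"
proof -
  have "circle_coeff (\<lambda>z. \<Sum>k\<in>K. c k * z powi k) (- k) = circle_coeff (\<lambda>z. 0) (- k)"
    using assms(2) by (rule circle_coeff_cong)
  then show ?thesis
    using assms(1,3) by (simp add: circle_coeff_laurent) (simp add: circle_coeff_def)
qed

text \<open>On the circle \<open>cnj z\<close> is the inverse of z, so a real polynomial is a
  Laurent polynomial there, and multiplying by it only mixes the coefficients of
  \<open>f\<close>.\<close>

lemma circle_coeff_real_polynomial:
  assumes "real_polynomial_function p" "continuous_on (sphere 0 1) f" "\<And>k. circle_coeff f k = 0"
  shows "circle_coeff (\<lambda>z. of_real (p z) * f z) k = 0"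
  using assms
proof (induction p arbitrary: f k rule: real_polynomial_function.induct)
  case (linear p)
  have p: "p z = Re z * p 1 + Im z * p \<i>" for z
  proof -
    have "p z = p (Re z *\<^sub>R 1 + Im z *\<^sub>R \<i>)"
      by (rule arg_cong[of _ _ p]) (simp add: complex_eq_iff)
    also have "\<dots> = Re z * p 1 + Im z * p \<i>"
      using bounded_linear.linear[OF linear(1)] by (simp only: linear_add linear_cmul) simp
    finally show ?thesis .
  qed
  \<comment> \<open>\<open>a\<close> and \<open>b\<close> are the coefficients of z and of
    \<open>cnj z\<close> in the real-linear function \<open>p\<close>.\<close>
  define a where "a = (of_real (p 1) - \<i> * of_real (p \<i>)) / 2"
  define b where "b = (of_real (p 1) + \<i> * of_real (p \<i>)) / 2"
  have "circle_coeff (\<lambda>z. of_real (p z) * f z) k =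
      circle_coeff (\<lambda>z. a * (z powi 1 * f z) + b * (z powi (-1) * f z)) k"
  proof (rule circle_coeff_cong)
    fix z :: complex assume "z \<in> sphere 0 1"
    then have "z powi (-1) = cnj z"
      by (simp add: power_int_minus inverse_eq_divide complex_div_cnj[of 1])
    moreover have "of_real (p z) = a * z + b * cnj z"
      by (simp add: p[of z] a_def b_def complex_eq_iff field_simps)
    ultimately show "of_real (p z) * f z = a * (z powi 1 * f z) + b * (z powi (-1) * f z)"
      by (simp add: algebra_simps)
  qed
  also have "\<dots> = a * circle_coeff f (k + 1) + b * circle_coeff f (k - 1)"
    using linear(2)
    by (subst circle_coeff_add)
      (auto simp only: circle_coeff_cmult circle_coeff_shift intro!: continuous_intros continuous_on_powi, simp)
  finally show ?case
    using linear by simp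
next
  case (const c)
  then show ?case
    by (simp add: circle_coeff_cmult)
next
  case (add p q)
  have "continuous_on (sphere 0 1) p" "continuous_on (sphere 0 1) q"
    using add by (auto intro: continuous_on_polymonial_function simp: real_polynomial_function_eq)
  then show ?case
    using add by (simp add: distrib_right circle_coeff_add continuous_intros)
next
  case (mult p q)
  have q: "continuous_on (sphere 0 1) q"
    using mult by (auto intro: continuous_on_polymonial_function simp: real_polynomial_function_eq)
  \<comment> \<open>The hypothesis for \<open>p\<close> is applied to the function q f, whose
    coefficients vanish by the one for \<open>q\<close>; hence the induction is over all
    \<open>f\<close>.\<close>
  have "circle_coeff (\<lambda>z. of_real (p z) * (of_real (q z) * f z)) k = 0"
    by (rule mult.IH(1)) (auto intro!: mult continuous_intros q)
  then show ?case
    by (simp add: mult.assoc)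
qed

text \<open>Completeness of the Fourier system via Stone-Weierstrass: Re f integrates to zero
  against every real polynomial, in particular against approximations of itself, so its square has
  integral at most any e > 0.\<close>

lemma Re_eq_0_if_coeffs_0:
  assumes f: "continuous_on (sphere 0 1) f" and coeff: "\<And>k. circle_coeff f k = 0" and z: "z \<in> sphere 0 1"
  shows "Re (f z) = 0"
proof -
  let ?I = "\<lambda>g. integral {0..2 * pi} (\<lambda>t. g (cis t) :: real)"
  have int: "(\<lambda>t. g (cis t)) integrable_on {0..2 * pi}" if "continuous_on (sphere 0 1) g"
    for g :: "complex \<Rightarrow> real"
    by (intro integrable_continuous_real continuous_on_circle that)
  have Re_f: "continuous_on (sphere 0 1) (\<lambda>z. Re (f z))"
    by (intro continuous_intros f)
  obtain B where B: "B > 0" "\<And>z. z \<in> sphere 0 1 \<Longrightarrow> \<bar>Re (f z)\<bar> \<le> B"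
    using compact_continuous_image[OF Re_f compact_sphere, THEN compact_imp_bounded]
    by (auto simp: bounded_pos)
  have "?I (\<lambda>z. (Re (f z))\<^sup>2) \<le> 0 + e" if "e > 0" for e
  proof -
    define d where "d = e / (2 * pi * B)"
    have d: "d > 0"
      using that B by (simp add: d_def)
    obtain p where p: "real_polynomial_function p" "\<And>z. z \<in> sphere 0 1 \<Longrightarrow> \<bar>Re (f z) - p z\<bar> < d"
      using Stone_Weierstrass_real_polynomial_function[OF compact_sphere Re_f d] by blast
    have cp: "continuous_on (sphere 0 1) p"
      using p by (auto intro: continuous_on_polymonial_function simp: real_polynomial_function_eq)
    have "0 = Re (circle_coeff (\<lambda>z. of_real (p z) * f z) 0)"
      using circle_coeff_real_polynomial[OF p(1) f coeff] by simp
    also have "\<dots> = (\<integral>t. Re (of_real (p (cis t)) * f (cis t)) \<partial>circle_measure)"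
      unfolding circle_coeff_def
      by (subst integral_Re[symmetric]) (auto intro!: integrable_circle[of "\<lambda>z. of_real (p z) * f z"] continuous_intros cp f)
    also have "\<dots> = ?I (\<lambda>z. p z * Re (f z))"
      by (subst lebesgue_integral_eq_integral)
        (auto intro!: integrable_circle[of "\<lambda>z. p z * Re (f z)"] continuous_intros cp f)
    finally have "?I (\<lambda>z. (Re (f z))\<^sup>2) = ?I (\<lambda>z. (Re (f z))\<^sup>2) - ?I (\<lambda>z. p z * Re (f z))"
      by simp
    also have "\<dots> = ?I (\<lambda>z. (Re (f z))\<^sup>2 - p z * Re (f z))"
      by (rule integral_diff[symmetric]) (intro int continuous_intros cp f)+
    also have "\<dots> \<le> ?I (\<lambda>z. d * B)"
    proof (rule integral_le)
      fix t :: real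
      have "(Re (f (cis t)) - p (cis t)) * Re (f (cis t)) \<le> \<bar>Re (f (cis t)) - p (cis t)\<bar> * \<bar>Re (f (cis t))\<bar>"
        by (metis abs_ge_self abs_mult)
      also have "\<dots> \<le> d * B"
        using p(2)[of "cis t"] B(2)[of "cis t"] d by (intro mult_mono) auto
      finally show "(Re (f (cis t)))\<^sup>2 - p (cis t) * Re (f (cis t)) \<le> d * B"
        by (simp add: power2_eq_square algebra_simps)
    qed (intro int continuous_intros cp f)+
    also have "\<dots> = 0 + e"
      using B by (simp add: d_def)
    finally show ?thesis .
  qed
  then have "?I (\<lambda>z. (Re (f z))\<^sup>2) \<le> 0"
    by (rule field_le_epsilon)
  moreover have "?I (\<lambda>z. (Re (f z))\<^sup>2) \<ge> 0"
    by (rule integral_nonneg) (auto intro!: int continuous_intros f)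
  ultimately have "?I (\<lambda>z. (Re (f z))\<^sup>2) = 0"
    by simp
  then have "\<forall>t\<in>{0..2 * pi}. (Re (f (cis t)))\<^sup>2 = 0"
    by (subst (asm) integral_eq_0_iff) (auto intro!: continuous_intros continuous_on_circle f)
  moreover obtain t where "t \<in> {0..2 * pi}" "z = cis t"
    using z sphere_cis by blast
  ultimately show ?thesis
    by simp
qed

lemma eq_0_if_coeffs_0:
  assumes "continuous_on (sphere 0 1) f" "\<And>k. circle_coeff f k = 0" "z \<in> sphere 0 1"
  shows "f z = 0"
proof -
  have "Re (\<i> * f z) = 0"
    using assms by (intro Re_eq_0_if_coeffs_0[of "\<lambda>z. \<i> * f z"]) (auto intro!: continuous_intros simp: circle_coeff_cmult)
  then show ?thesis
    using Re_eq_0_if_coeffs_0[OF assms] by (simp add: complex_eq_iff)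
qed

lemma laurent_polynomial_if_coeffs:
  assumes f: "continuous_on (sphere 0 1) f" and "finite K" and coeff: "\<And>k. - k \<notin> K \<Longrightarrow> circle_coeff f k = 0"
    and "z \<in> sphere 0 1"
  shows "f z = (\<Sum>k\<in>K. circle_coeff f (- k) / (2 * pi) * z powi k)"
proof -
  let ?g = "\<lambda>z. \<Sum>k\<in>K. circle_coeff f (- k) / (2 * pi) * z powi k"
  have g: "continuous_on (sphere 0 1) ?g"
    by (intro continuous_intros continuous_on_powi)
  have "f z - ?g z = 0"
  proof (rule eq_0_if_coeffs_0[of "\<lambda>z. f z - ?g z"])
    show "circle_coeff (\<lambda>z. f z - ?g z) k = 0" for k
      using coeff[of k] unfolding circle_coeff_diff[OF f g] circle_coeff_laurent[OF assms(2)] by simp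
  qed (intro continuous_intros f g assms)+
  then show ?thesis
    by simp
qed

lemma laurent_unique_matrix:
  fixes M :: "int \<Rightarrow> complex^'n^'m"
  assumes "finite K" "\<And>z. z \<in> sphere 0 1 \<Longrightarrow> (\<Sum>k\<in>K. z powi k *\<^sub>M M k) = 0" "k \<in> K"
  shows "M k = 0"
proof -
  have "M k $ i $ j = 0" for i j
  proof (rule laurent_unique[OF assms(1) _ assms(3)])
    fix z :: complex assume "z \<in> sphere 0 1"
    from arg_cong[OF assms(2)[OF this], of "\<lambda>A. A $ i $ j"]
    show "(\<Sum>k\<in>K. M k $ i $ j * z powi k) = 0"
      by (simp add: mult.commute)
  qed
  then show ?thesis
    by (simp add: vec_eq_iff)
qed

section \<open>Loops between the Hardy space and its shift\<close>

lemma continuous_L2_circle: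
  assumes "continuous_on (sphere 0 1) f"
  shows "f \<in> L2_circle"
  using assms unfolding L2_circle_def
  by (auto intro!: continuous_imp_measurable_on_sets_lebesgue continuous_on_circle
      integrable_circle[of "\<lambda>z. (norm (f z))\<^sup>2"] continuous_intros)

lemma fourier_coeff_nth:
  assumes "continuous_on (sphere 0 1) f"
  shows "fourier_coeff f k $ i = circle_coeff (\<lambda>z. f z $ i) (- k) / (2 * pi)"
proof -
  have eq: "cis (- (of_int k * t)) *s f (cis t) = cis t powi (- k) *s f (cis t)" for t
    by (simp add: cis_power_int)
  have "continuous_on (sphere 0 1) (\<lambda>z. \<chi> i. z powi (- k) * f z $ i)"
    by (intro continuous_on_vec_lambda continuous_intros continuous_on_powi assms)
  then have "integrable circle_measure (\<lambda>t. cis t powi (- k) *s f (cis t))"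
    unfolding vector_scalar_mult_def by (rule integrable_circle)
  from integral_bounded_linear[OF bounded_linear_vec_nth this, of i]
  show ?thesis
    unfolding fourier_coeff_def eq circle_coeff_def
    by (simp add: scaleR_conv_of_real[where 'a = complex] field_simps)
qed

lemma H_plus_continuous:
  assumes "continuous_on (sphere 0 1) f"
  shows "f \<in> H_plus \<longleftrightarrow> (\<forall>k>0. \<forall>i. circle_coeff (\<lambda>z. f z $ i) k = 0)"
proof -
  have "f \<in> H_plus \<longleftrightarrow> (\<forall>k<0. \<forall>i. circle_coeff (\<lambda>z. f z $ i) (- k) = 0)"
    by (simp add: H_plus_def continuous_L2_circle[OF assms] vec_eq_iff fourier_coeff_nth[OF assms])
  also have "\<dots> \<longleftrightarrow> (\<forall>k>0. \<forall>i. circle_coeff (\<lambda>z. f z $ i) k = 0)"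
    by (metis minus_minus neg_0_less_iff_less neg_less_0_iff_less)
  finally show ?thesis .
qed

lemma H_plus_AE:
  assumes "f \<in> H_plus" "g \<in> L2_circle" "AE t in circle_measure. f (cis t) = g (cis t)"
  shows "g \<in> H_plus"
proof -
  have meas: "(\<lambda>t. cis (- (of_int k * t)) *s h (cis t)) \<in> borel_measurable circle_measure"
    if "h \<in> L2_circle" for h :: "complex \<Rightarrow> complex^'a" and k
  proof -
    have "continuous_on UNIV (\<lambda>p :: complex \<times> (complex^'a). \<chi> i. fst p * snd p $ i)"
      by (intro continuous_on_vec_lambda continuous_intros)
    then have "(\<lambda>p :: complex \<times> (complex^'a). fst p *s snd p) \<in> borel_measurable borel"
      unfolding vector_scalar_mult_def by (rule borel_measurable_continuous_onI)
    moreover have "(\<lambda>t. cis (- (of_int k * t))) \<in> borel_measurable circle_measure"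
      by (intro continuous_imp_measurable_on_sets_lebesgue continuous_intros) auto
    then have "(\<lambda>t. (cis (- (of_int k * t)), h (cis t))) \<in> borel_measurable circle_measure"
      using that unfolding L2_circle_def by (intro borel_measurable_Pair) auto
    ultimately have "(\<lambda>t. (\<lambda>p. fst p *s snd p) (cis (- (of_int k * t)), h (cis t))) \<in> borel_measurable circle_measure"
      by (rule measurable_compose[rotated])
    then show ?thesis
      by simp
  qed
  have "fourier_coeff f k = fourier_coeff g k" for k
    unfolding fourier_coeff_def using assms
    by (intro arg_cong[where f = "(*\<^sub>R) _"] integral_cong_AE meas) (auto simp: H_plus_def)
  then show ?thesis
    using assms by (simp add: H_plus_def)
qed

locale unitary_loop =
  fixes \<gamma> :: "complex \<Rightarrow> complex^'n^'n"
  assumes unitary: "z \<in> sphere 0 1 \<Longrightarrow> \<gamma> z \<in> unitary_group"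
    and continuous: "continuous_on (sphere 0 1) \<gamma>"
begin

lemma unitary_mult: "z \<in> sphere 0 1 \<Longrightarrow> ctranspose (\<gamma> z) *v (\<gamma> z *v x) = x"
    "z \<in> sphere 0 1 \<Longrightarrow> \<gamma> z *v (ctranspose (\<gamma> z) *v x) = x"
  using unitary by (simp_all add: matrix_vector_mul_assoc unitary_group_def)

lemma continuous_mult:
  assumes "continuous_on (sphere 0 1) g"
  shows "continuous_on (sphere 0 1) (\<lambda>z. \<gamma> z *v g z)"
    "continuous_on (sphere 0 1) (\<lambda>z. ctranspose (\<gamma> z) *v g z)"
  unfolding matrix_vector_mult_def ctranspose_def using assms continuous
  by (auto intro!: continuous_intros)

lemma loop_image_iff:
  assumes g: "continuous_on (sphere 0 1) g"
  shows "g \<in> loop_image \<gamma> H_plus \<longleftrightarrow> (\<lambda>z. ctranspose (\<gamma> z) *v g z) \<in> H_plus"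
proof
  assume "g \<in> loop_image \<gamma> H_plus"
  then obtain f where f: "f \<in> H_plus" "AE t in circle_measure. g (cis t) = \<gamma> (cis t) *v f (cis t)"
    by (auto simp: loop_image_def)
  from f(2) have "AE t in circle_measure. f (cis t) = ctranspose (\<gamma> (cis t)) *v g (cis t)"
    by (rule AE_mp) (auto intro!: AE_I2 simp: unitary_mult)
  then show "(\<lambda>z. ctranspose (\<gamma> z) *v g z) \<in> H_plus"
    using f(1) by (intro H_plus_AE[OF f(1)] continuous_L2_circle continuous_mult g)
next
  assume "(\<lambda>z. ctranspose (\<gamma> z) *v g z) \<in> H_plus"
  then show "g \<in> loop_image \<gamma> H_plus"
    using continuous_L2_circle[OF g] unfolding loop_image_def
    by (auto intro!: bexI[of _ "\<lambda>z. ctranspose (\<gamma> z) *v g z"] simp: unitary_mult)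
qed

text \<open>Constants lie in the Hardy space, so the inclusion applied to basis vectors shows that
  the columns of the loop have no negative Fourier modes.\<close>

lemma column_coeff_pos:
  assumes "loop_image \<gamma> H_plus \<subseteq> H_plus" "k > 0"
  shows "circle_coeff (\<lambda>z. \<gamma> z $ i $ j) k = 0"
proof -
  have const: "(\<lambda>z::complex. axis j 1 :: complex^'n) \<in> H_plus"
  proof (subst H_plus_continuous)
    have "circle_coeff (\<lambda>z. axis j 1 $ i) l = 0" if "l > 0" for l and i :: 'n
      using circle_coeff_laurent[of "{0}" "\<lambda>_. axis j 1 $ i" l] that by simp
    then show "\<forall>k>0. \<forall>i. circle_coeff (\<lambda>z. axis j 1 $ i) k = 0"
      by blast
  qed simp
  have "(\<lambda>z. \<gamma> z *v axis j 1) \<in> loop_image \<gamma> H_plus"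
    using const continuous_L2_circle[OF continuous_mult(1)] unfolding loop_image_def by force
  then have "(\<lambda>z. \<gamma> z *v axis j 1) \<in> H_plus"
    using assms(1) by blast
  then have "circle_coeff (\<lambda>z. (\<gamma> z *v axis j 1) $ i) k = 0"
    using assms(2) by (subst (asm) H_plus_continuous) (auto intro!: continuous_mult)
  moreover have "(\<gamma> z *v axis j 1) $ i = \<gamma> z $ i $ j" for z
    by (simp add: matrix_vector_mult_def axis_def if_distrib if_distribR cong: if_cong)
  ultimately show ?thesis
    by simp
qed

text \<open>Since \<zeta>^r e_i lies in the image, \<zeta>^r times the adjoint loop applied to e_i
  lies in the Hardy space. Conjugation reverses the index, which bounds the degree of the loop by
  r.\<close>

lemma column_coeff_less:
  assumes "loop_image (\<lambda>z. mat (z ^ r)) H_plus \<subseteq> loop_image \<gamma> H_plus" "k < - int r"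
  shows "circle_coeff (\<lambda>z. \<gamma> z $ i $ j) k = 0"
proof -
  have const: "(\<lambda>z::complex. axis i 1 :: complex^'n) \<in> H_plus"
  proof (subst H_plus_continuous)
    have "circle_coeff (\<lambda>z. axis i 1 $ j) l = 0" if "l > 0" for l and j :: 'n
      using circle_coeff_laurent[of "{0}" "\<lambda>_. axis i 1 $ j" l] that by simp
    then show "\<forall>k>0. \<forall>j. circle_coeff (\<lambda>z. axis i 1 $ j) k = 0"
      by blast
  qed simp
  have mat: "mat (z ^ r) *v axis i 1 = z ^ r *s (axis i 1 :: complex^'n)" for z :: complex
    by (simp add: vec_eq_iff matrix_vector_mult_def mat_def mult_delta_left)
  have cont: "continuous_on (sphere 0 1) (\<lambda>z. z ^ r *s (axis i 1 :: complex^'n))"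
    unfolding vector_scalar_mult_def by (intro continuous_on_vec_lambda continuous_intros)
  have "(\<lambda>z. z ^ r *s (axis i 1 :: complex^'n)) \<in> loop_image (\<lambda>z. mat (z ^ r)) H_plus"
    using const continuous_L2_circle[OF cont] unfolding loop_image_def by (force simp: mat)
  then have "(\<lambda>z. ctranspose (\<gamma> z) *v (z ^ r *s axis i 1)) \<in> H_plus"
    using assms(1) loop_image_iff[OF cont] by blast
  then have "circle_coeff (\<lambda>z. (ctranspose (\<gamma> z) *v (z ^ r *s axis i 1)) $ j) (- k - int r) = 0"
    using assms(2) by (subst (asm) H_plus_continuous) (auto intro!: continuous_mult cont)
  also have "circle_coeff (\<lambda>z. (ctranspose (\<gamma> z) *v (z ^ r *s axis i 1)) $ j) (- k - int r) =
      circle_coeff (\<lambda>z. z powi (int r) * cnj (\<gamma> z $ i $ j)) (- k - int r)"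
    by (rule arg_cong[where f = "\<lambda>f. circle_coeff f _"])
      (auto simp: fun_eq_iff matrix_vector_mult_def axis_def if_distrib if_distribR cong: if_cong)
  also have "\<dots> = circle_coeff (\<lambda>z. cnj (\<gamma> z $ i $ j)) (- k)"
    unfolding circle_coeff_shift by simp
  also have "\<dots> = cnj (circle_coeff (\<lambda>z. \<gamma> z $ i $ j) k)"
    unfolding circle_coeff_def Bochner_Integration.integral_cnj[symmetric]
    by (intro Bochner_Integration.integral_cong) (simp_all add: cis_power_int cis_cnj)
  finally show ?thesis
    by simp
qed

lemma polynomial:
  assumes "loop_image (\<lambda>z. mat (z ^ r)) H_plus \<subseteq> loop_image \<gamma> H_plus" "loop_image \<gamma> H_plus \<subseteq> H_plus"
    and "z \<in> sphere 0 1"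
  shows "\<gamma> z = (\<Sum>k=0..int r. z powi k *\<^sub>M (\<chi> i j. circle_coeff (\<lambda>z. \<gamma> z $ i $ j) (- k) / (2 * pi)))"
proof -
  have "\<gamma> z $ i $ j = (\<Sum>k=0..int r. circle_coeff (\<lambda>z. \<gamma> z $ i $ j) (- k) / (2 * pi) * z powi k)" for i j
  proof (rule laurent_polynomial_if_coeffs)
    fix k assume k: "- k \<notin> {0..int r}"
    then have "k > 0 \<or> k < - int r"
      by auto
    then show "circle_coeff (\<lambda>z. \<gamma> z $ i $ j) k = 0"
      using column_coeff_pos column_coeff_less assms by blast
  qed (use assms in \<open>auto intro!: continuous_intros continuous\<close>)
  then show ?thesis
    by (simp add: vec_eq_iff mult.commute)
qed

end

section \<open>Coefficient identities of a unitary polynomial loop\<close>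

locale unitary_polynomial_loop =
  fixes \<gamma> :: "complex \<Rightarrow> complex^'n^'n" and T :: "int \<Rightarrow> complex^'n^'n" and r :: nat
  assumes loop_unitary: "z \<in> sphere 0 1 \<Longrightarrow> \<gamma> z \<in> unitary_group"
    and supp: "k \<notin> {0..int r} \<Longrightarrow> T k = 0"
    and expansion: "z \<in> sphere 0 1 \<Longrightarrow> \<gamma> z = (\<Sum>k=0..int r. z powi k *\<^sub>M T k)"
begin

sublocale unitary_loop \<gamma>
proof
  have "continuous_on (sphere 0 1) (\<lambda>z. \<Sum>k=0..int r. \<chi> i j. z powi k * T k $ i $ j)"
    by (intro continuous_on_sum continuous_on_vec_lambda continuous_intros continuous_on_powi)
  then show "continuous_on (sphere 0 1) \<gamma>"
    by (rule continuous_on_eq) (simp add: expansion cscale_def)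
qed (rule loop_unitary)

lemma cnj_powi: "z \<in> sphere 0 1 \<Longrightarrow> cnj (z powi k) = z powi (- k)"
  using sphere_cis[of z] by (auto simp: cis_power_int cis_cnj)

lemma powi_add: "z \<in> sphere (0 :: complex) 1 \<Longrightarrow> z powi (i + j) = z powi i * z powi j"
  by (rule power_int_add) auto

lemma ctranspose_expansion:
  assumes "z \<in> sphere 0 1"
  shows "ctranspose (\<gamma> z) = (\<Sum>k=0..int r. z powi (- k) *\<^sub>M ctranspose (T k))"
  by (simp add: expansion[OF assms] ctranspose_sum cnj_powi[OF assms] del: complex_cnj_power_int)

lemma convolution_left:
  "(\<Sum>k=0..int r. ctranspose (T k) ** T (k + m)) = (if m = 0 then mat 1 else 0)"
proof -
  \<comment> \<open>Wide enough for all differences of two indices from 0 to r, and for m itself,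
    where uniqueness is evaluated.\<close>
  define K where "K = {- int r - \<bar>m\<bar>..int r + \<bar>m\<bar>}"
  \<comment> \<open>The coefficient of \<zeta>^l in \<gamma>^* \<gamma> - 1.\<close>
  define M where "M l = (\<Sum>k=0..int r. ctranspose (T k) ** T (k + l)) - (if l = 0 then mat 1 else 0)" for l
  have "M m = 0"
  proof (rule laurent_unique_matrix[of K M])
    fix z :: complex assume z: "z \<in> sphere 0 1"
    have inner: "(\<Sum>l\<in>K. z powi (k + l) *\<^sub>M T (k + l)) = \<gamma> z" if k: "k \<in> {0..int r}" for k
    proof -
      have "(\<Sum>l\<in>K. z powi (k + l) *\<^sub>M T (k + l)) = (\<Sum>l=-k..int r - k. z powi (k + l) *\<^sub>M T (k + l))"
        using k by (intro sum.mono_neutral_right) (auto simp: K_def supp)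
      also have "\<dots> = (\<Sum>l=0..int r. z powi l *\<^sub>M T l)"
        by (rule sum.reindex_bij_witness[of _ "\<lambda>l. l - k" "\<lambda>l. k + l"]) auto
      finally show ?thesis
        using expansion[OF z] by simp
    qed
    have "(\<Sum>l\<in>K. z powi l *\<^sub>M M l) =
        (\<Sum>l\<in>K. \<Sum>k=0..int r. (z powi (- k) *\<^sub>M ctranspose (T k)) ** (z powi (k + l) *\<^sub>M T (k + l))) - mat 1"
    proof -
      have "(\<Sum>l\<in>K. z powi l *\<^sub>M (if l = 0 then mat 1 else 0)) =
          (\<Sum>l\<in>K. if l = 0 then mat 1 else (0 :: complex^'n^'n))"
        by (intro sum.cong) auto
      also have "\<dots> = mat 1"
        by (simp add: K_def)
      finally have "(\<Sum>l\<in>K. z powi l *\<^sub>M (if l = 0 then mat 1 else 0)) = (mat 1 :: complex^'n^'n)" .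
      moreover have "z powi l = z powi (- k) * z powi (k + l)" for k l
        using powi_add[OF z, of "- k" "k + l"] by simp
      ultimately show ?thesis
        by (simp add: M_def cscale_distribs sum_subtractf cscale_sum_right mult.commute)
    qed
    also have "(\<Sum>l\<in>K. \<Sum>k=0..int r. (z powi (- k) *\<^sub>M ctranspose (T k)) ** (z powi (k + l) *\<^sub>M T (k + l))) =
        (\<Sum>k=0..int r. (z powi (- k) *\<^sub>M ctranspose (T k)) ** \<gamma> z)"
      by (subst sum.swap) (simp only: matrix_mul_sum_right[symmetric] inner cong: sum.cong)
    also have "\<dots> = mat 1"
      unfolding matrix_mul_sum_left[symmetric] ctranspose_expansion[OF z, symmetric]
      using unitary[OF z] by (simp add: unitary_group_def)
    finally show "(\<Sum>l\<in>K. z powi l *\<^sub>M M l) = 0"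
      by simp
  qed (auto simp: K_def)
  then show ?thesis
    by (simp add: M_def)
qed

lemma convolution_right:
  "(\<Sum>k=0..int r. T (k + m) ** ctranspose (T k)) = (if m = 0 then mat 1 else 0)"
proof -
  define K where "K = {- int r - \<bar>m\<bar>..int r + \<bar>m\<bar>}"
  define M where "M l = (\<Sum>k=0..int r. T (k + l) ** ctranspose (T k)) - (if l = 0 then mat 1 else 0)" for l
  have "M m = 0"
  proof (rule laurent_unique_matrix[of K M])
    fix z :: complex assume z: "z \<in> sphere 0 1"
    have inner: "(\<Sum>l\<in>K. z powi (k + l) *\<^sub>M T (k + l)) = \<gamma> z" if k: "k \<in> {0..int r}" for k
    proof -
      have "(\<Sum>l\<in>K. z powi (k + l) *\<^sub>M T (k + l)) = (\<Sum>l=-k..int r - k. z powi (k + l) *\<^sub>M T (k + l))"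
        using k by (intro sum.mono_neutral_right) (auto simp: K_def supp)
      also have "\<dots> = (\<Sum>l=0..int r. z powi l *\<^sub>M T l)"
        by (rule sum.reindex_bij_witness[of _ "\<lambda>l. l - k" "\<lambda>l. k + l"]) auto
      finally show ?thesis
        using expansion[OF z] by simp
    qed
    have "(\<Sum>l\<in>K. z powi l *\<^sub>M M l) =
        (\<Sum>l\<in>K. \<Sum>k=0..int r. (z powi (k + l) *\<^sub>M T (k + l)) ** (z powi (- k) *\<^sub>M ctranspose (T k))) - mat 1"
    proof -
      have "(\<Sum>l\<in>K. z powi l *\<^sub>M (if l = 0 then mat 1 else 0)) =
          (\<Sum>l\<in>K. if l = 0 then mat 1 else (0 :: complex^'n^'n))"
        by (intro sum.cong) auto
      also have "\<dots> = mat 1"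
        by (simp add: K_def)
      finally have "(\<Sum>l\<in>K. z powi l *\<^sub>M (if l = 0 then mat 1 else 0)) = (mat 1 :: complex^'n^'n)" .
      moreover have "z powi l = z powi (- k) * z powi (k + l)" for k l
        using powi_add[OF z, of "- k" "k + l"] by simp
      ultimately show ?thesis
        by (simp add: M_def cscale_distribs sum_subtractf cscale_sum_right mult.commute)
    qed
    also have "(\<Sum>l\<in>K. \<Sum>k=0..int r. (z powi (k + l) *\<^sub>M T (k + l)) ** (z powi (- k) *\<^sub>M ctranspose (T k))) =
        (\<Sum>k=0..int r. \<gamma> z ** (z powi (- k) *\<^sub>M ctranspose (T k)))"
      by (subst sum.swap) (simp only: matrix_mul_sum_left[symmetric] inner cong: sum.cong)
    also have "\<dots> = mat 1"
      unfolding matrix_mul_sum_right[symmetric] ctranspose_expansion[OF z, symmetric]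
      using unitary[OF z] by (simp add: unitary_group_def)
    finally show "(\<Sum>l\<in>K. z powi l *\<^sub>M M l) = 0"
      by simp
  qed (auto simp: K_def)
  then show ?thesis
    by (simp add: M_def)
qed

lemma unitary_polynomial: "bij_betw deg UNIV {..<r} \<Longrightarrow> unitary_polynomial T r deg"
  by unfold_locales (auto simp: supp convolution_left convolution_right)

end

section \<open>Smooth maps\<close>

lemma smooth_differentiable: "smooth_on UNIV f \<Longrightarrow> f differentiable (at x)"
  unfolding smooth_on_def using Ck_on.simps(2)[of 0 UNIV f] by blast

lemma smooth_has_derivative:
  "smooth_on UNIV f \<Longrightarrow> (f has_derivative frechet_derivative f (at x)) (at x)"
  using smooth_differentiable frechet_derivative_works by blast

lemma smooth_frechet_derivative:
  "smooth_on UNIV f \<Longrightarrow> smooth_on UNIV (\<lambda>x. frechet_derivative f (at x) v)"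
  unfolding smooth_on_def using Ck_on.simps(2)[of _ UNIV f] by blast

lemma smooth_continuous: "smooth_on UNIV f \<Longrightarrow> continuous_on UNIV f"
  unfolding smooth_on_def using Ck_on.simps(1)[of UNIV f] by blast

text \<open>Joint smoothness in point and angle is given, but each spectral parameter is used
  separately. A derivative of the slice is a slice of a directional derivative, hence the induction
  over all \<open>G\<close>.\<close>

lemma smooth_slice:
  fixes G :: "'a::real_normed_vector \<times> 'b::real_normed_vector \<Rightarrow> 'c::real_normed_vector"
  assumes "smooth_on UNIV G"
  shows "smooth_on UNIV (\<lambda>x. G (x, t))"
proof -
  have "Ck_on k UNIV G \<Longrightarrow> Ck_on k UNIV (\<lambda>x. G (x, t))" for k and G :: "'a \<times> 'b \<Rightarrow> 'c"
  proof (induction k arbitrary: G)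
    case 0
    then show ?case
      by (auto intro!: continuous_on_compose2[of UNIV G] continuous_intros)
  next
    case (Suc k)
    have der: "((\<lambda>x. G (x, t)) has_derivative (\<lambda>v. frechet_derivative G (at (x, t)) (v, 0))) (at x)" for x
    proof (rule has_derivative_compose[of "\<lambda>x. (x, t)" "\<lambda>v. (v, 0)"])
      show "(G has_derivative frechet_derivative G (at (x, t))) (at (x, t))"
        using Suc.prems by (simp add: frechet_derivative_works)
    qed (auto intro!: derivative_eq_intros)
    then have "frechet_derivative (\<lambda>x. G (x, t)) (at x) = (\<lambda>v. frechet_derivative G (at (x, t)) (v, 0))" for x
      using frechet_derivative_at by metis
    moreover have "Ck_on k UNIV (\<lambda>x. frechet_derivative G (at (x, t)) (v, 0))" for v
      using Suc.prems by (intro Suc.IH) simp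
    ultimately show ?case
      using der by (auto simp: differentiable_def)
  qed
  then show ?thesis
    using assms by (simp add: smooth_on_def)
qed

section \<open>Symmetry of second derivatives\<close>

lemma second_difference:
  fixes g p :: "'a::real_normed_vector \<Rightarrow> real"
  assumes g: "\<And>x. (g has_derivative g' x) (at x)" and p: "\<And>x. (p has_derivative p' x) (at x)"
    and gu: "\<And>x. g' x u = p x" and h: "h > 0"
  obtains s t where "0 < s" "s < h" "0 < t" "t < h"
    "g (z + h *\<^sub>R u + h *\<^sub>R v) - g (z + h *\<^sub>R u) - g (z + h *\<^sub>R v) + g z = h * h * p' (z + s *\<^sub>R u + t *\<^sub>R v) v"
proof -
  have line: "((\<lambda>s. f (y + s *\<^sub>R w)) has_real_derivative f' (y + s *\<^sub>R w) w) (at s)"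
    if "\<And>x. (f has_derivative f' x) (at x)" for f :: "'a \<Rightarrow> real" and f' y w s
  proof -
    have "((\<lambda>s. f (y + s *\<^sub>R w)) has_derivative (\<lambda>d. f' (y + s *\<^sub>R w) (d *\<^sub>R w))) (at s)"
      by (rule has_derivative_compose[OF _ that]) (auto intro!: derivative_eq_intros)
    moreover have "f' (y + s *\<^sub>R w) (d *\<^sub>R w) = f' (y + s *\<^sub>R w) w * d" for d
      using has_derivative_linear[OF that] by (simp add: linear_cmul)
    ultimately show ?thesis
      by (simp add: has_field_derivative_def)
  qed
  let ?\<phi> = "\<lambda>s. g (z + h *\<^sub>R v + s *\<^sub>R u) - g (z + s *\<^sub>R u)"
  \<comment> \<open>Mean value theorem along u, for the difference of \<open>g\<close> on two
    parallel segments; the next application goes along v.\<close>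
  have "\<exists>s>0. s < h \<and> ?\<phi> h - ?\<phi> 0 = (h - 0) * (p (z + h *\<^sub>R v + s *\<^sub>R u) - p (z + s *\<^sub>R u))"
    using h by (intro MVT2 DERIV_diff) (use line[OF g, of _ u] gu in auto)
  then obtain s where s: "0 < s" "s < h"
    "?\<phi> h - ?\<phi> 0 = h * (p (z + h *\<^sub>R v + s *\<^sub>R u) - p (z + s *\<^sub>R u))"
    by auto
  have "\<exists>t>0. t < h \<and> p (z + s *\<^sub>R u + h *\<^sub>R v) - p (z + s *\<^sub>R u + 0 *\<^sub>R v) = (h - 0) * p' (z + s *\<^sub>R u + t *\<^sub>R v) v"
    using h by (intro MVT2) (use line[OF p] in auto)
  then obtain t where t: "0 < t" "t < h"
    "p (z + s *\<^sub>R u + h *\<^sub>R v) - p (z + s *\<^sub>R u) = h * p' (z + s *\<^sub>R u + t *\<^sub>R v) v"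
    by auto
  show ?thesis
    using that[OF s(1,2) t(1,2)] s(3) t(3) by (simp add: algebra_simps)
qed

text \<open>The second difference over a parallelogram is symmetric in u and v, and by
  \<open>second_difference\<close> it equals h * h times either mixed derivative at some nearby
  point; continuity then excludes different values at z.\<close>

lemma mixed_derivatives_commute:
  fixes g p q :: "'a::real_normed_vector \<Rightarrow> real"
  assumes g: "\<And>x. (g has_derivative g' x) (at x)"
    and p: "\<And>x. (p has_derivative p' x) (at x)" and q: "\<And>x. (q has_derivative q' x) (at x)"
    and gu: "\<And>x. g' x u = p x" and gv: "\<And>x. g' x v = q x"
    and cont: "isCont (\<lambda>x. p' x v) z" "isCont (\<lambda>x. q' x u) z"
  shows "p' z v = q' z u"
proof (rule ccontr)
  assume "p' z v \<noteq> q' z u"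
  define e where "e = \<bar>p' z v - q' z u\<bar> / 2"
  have e: "e > 0"
    using \<open>p' z v \<noteq> q' z u\<close> by (simp add: e_def)
  obtain d1 where d1: "d1 > 0" "\<And>x. dist x z < d1 \<Longrightarrow> \<bar>p' x v - p' z v\<bar> < e"
    using cont(1) e unfolding continuous_at_eps_delta dist_real_def by blast
  obtain d2 where d2: "d2 > 0" "\<And>x. dist x z < d2 \<Longrightarrow> \<bar>q' x u - q' z u\<bar> < e"
    using cont(2) e unfolding continuous_at_eps_delta dist_real_def by blast
  define d where "d = min d1 d2"
  have d: "d > 0" "\<And>x. dist x z < d \<Longrightarrow> \<bar>p' x v - p' z v\<bar> < e \<and> \<bar>q' x u - q' z u\<bar> < e"
    using d1 d2 by (auto simp: d_def)
  \<comment> \<open>Keeps the parallelogram spanned by h u and h v inside the ball of radius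
    d.\<close>
  define h where "h = d / (norm u + norm v + 1)"
  have h: "h > 0" and hd: "h * (norm u + norm v) < d"
    using d(1) by (simp_all add: h_def divide_simps add_nonneg_pos algebra_simps add_pos_nonneg)
  have near: "dist (z + s *\<^sub>R u + t *\<^sub>R v) z < d" if "0 < s" "s < h" "0 < t" "t < h" for s t
  proof -
    have "dist (z + s *\<^sub>R u + t *\<^sub>R v) z \<le> norm (s *\<^sub>R u) + norm (t *\<^sub>R v)"
      by (simp add: dist_norm add.assoc del: norm_scaleR) (rule norm_triangle_ineq)
    also have "\<dots> \<le> h * norm u + h * norm v"
      using that by (intro add_mono) (auto intro!: mult_right_mono)
    finally show ?thesis
      using hd by (simp add: algebra_simps)
  qed
  obtain s t where st: "0 < s" "s < h" "0 < t" "t < h"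
    "g (z + h *\<^sub>R u + h *\<^sub>R v) - g (z + h *\<^sub>R u) - g (z + h *\<^sub>R v) + g z = h * h * p' (z + s *\<^sub>R u + t *\<^sub>R v) v"
    using second_difference[where g' = g' and p' = p' and p = p, OF g p gu h] by blast
  obtain s' t' where st': "0 < s'" "s' < h" "0 < t'" "t' < h"
    "g (z + h *\<^sub>R v + h *\<^sub>R u) - g (z + h *\<^sub>R v) - g (z + h *\<^sub>R u) + g z = h * h * q' (z + s' *\<^sub>R v + t' *\<^sub>R u) u"
    using second_difference[where g' = g' and p' = q' and p = q, OF g q gv h] by blast
  have "h * h * p' (z + s *\<^sub>R u + t *\<^sub>R v) v = h * h * q' (z + t' *\<^sub>R u + s' *\<^sub>R v) u"
    using st(5) st'(5) by (simp add: algebra_simps)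
  then have "p' (z + s *\<^sub>R u + t *\<^sub>R v) v = q' (z + t' *\<^sub>R u + s' *\<^sub>R v) u"
    using h by simp
  moreover have "\<bar>p' (z + s *\<^sub>R u + t *\<^sub>R v) v - p' z v\<bar> < e" "\<bar>q' (z + t' *\<^sub>R u + s' *\<^sub>R v) u - q' z u\<bar> < e"
    using d(2) near st st' by blast+
  ultimately have "\<bar>p' z v - q' z u\<bar> < e + e"
    by linarith
  then show False
    by (simp add: e_def)
qed

lemma frechet_derivative_commute:
  fixes f :: "'a::real_normed_vector \<Rightarrow> 'b::euclidean_space"
  assumes f: "smooth_on UNIV f"
  shows "frechet_derivative (\<lambda>x. frechet_derivative f (at x) u) (at z) v =
    frechet_derivative (\<lambda>x. frechet_derivative f (at x) v) (at z) u"
proof (rule euclidean_eqI)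
  fix b :: 'b
  let ?D = "\<lambda>u v x. frechet_derivative (\<lambda>x. frechet_derivative f (at x) u) (at x) v"
  have cont: "isCont (\<lambda>x. ?D u v x \<bullet> b) z" for u v
    using smooth_continuous[OF smooth_frechet_derivative[OF smooth_frechet_derivative[OF f]]]
    by (intro continuous_intros) (auto simp: continuous_on_eq_continuous_at)
  have der: "((\<lambda>x. frechet_derivative f (at x) u \<bullet> b) has_derivative (\<lambda>v. ?D u v x \<bullet> b)) (at x)" for u x
    by (intro has_derivative_inner_left smooth_has_derivative smooth_frechet_derivative f)
  show "?D u v z \<bullet> b = ?D v u z \<bullet> b"
  proof (rule mixed_derivatives_commute[where g = "\<lambda>x. f x \<bullet> b" and p = "\<lambda>x. frechet_derivative f (at x) u \<bullet> b"
        and q = "\<lambda>x. frechet_derivative f (at x) v \<bullet> b" and p' = "\<lambda>x v. ?D u v x \<bullet> b" and q' = "\<lambda>x u. ?D v u x \<bullet> b"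
        and g' = "\<lambda>x v. frechet_derivative f (at x) v \<bullet> b"])
    show "((\<lambda>x. f x \<bullet> b) has_derivative (\<lambda>v. frechet_derivative f (at x) v \<bullet> b)) (at x)" for x
      by (intro has_derivative_inner_left smooth_has_derivative f)
  qed (rule der cont refl)+
qed

section \<open>The holomorphic quadratic differential of a harmonic map\<close>

lemma A_z_eqI:
  assumes "U z \<in> unitary_group"
    and "\<And>v. frechet_derivative U (at z) v = 2 *\<^sub>M (U z ** (v *\<^sub>M B - cnj v *\<^sub>M ctranspose B))"
  shows "A_z U z = B"
proof -
  have "wirtinger_z U z = 2 *\<^sub>M (U z ** B)"
    by (simp add: wirtinger_z_def assms(2) matrix_mul_distribs cscale_distribs) (simp add: vec_eq_iff)
  then show ?thesis
    using assms(1) by (simp add: A_z_def unitary_matrix_inv matrix_mul_assoc unitary_group_def)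
qed

context
  fixes U :: "complex \<Rightarrow> complex^'n^'n" and z :: complex
  assumes unitary: "\<And>x. U x \<in> unitary_group" and diff: "U differentiable (at z)"
begin

lemma skew_hermitian:
  "ctranspose (ctranspose (U z) ** frechet_derivative U (at z) v) =
    - (ctranspose (U z) ** frechet_derivative U (at z) v)"
proof -
  have D: "(U has_derivative frechet_derivative U (at z)) (at z)"
    using diff by (simp add: frechet_derivative_works)
  have "((\<lambda>x. ctranspose (U x) ** U x) has_derivative (\<lambda>v. ctranspose (U z) ** frechet_derivative U (at z) v +
      ctranspose (frechet_derivative U (at z) v) ** U z)) (at z)"
    by (rule matrix_mult_has_derivative[OF ctranspose_has_derivative[OF D] D])
  moreover have "(\<lambda>x. ctranspose (U x) ** U x) = (\<lambda>x. mat 1)"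
    using unitary by (simp add: unitary_group_def)
  ultimately have "((\<lambda>x. mat 1) has_derivative (\<lambda>v. ctranspose (U z) ** frechet_derivative U (at z) v +
      ctranspose (frechet_derivative U (at z) v) ** U z)) (at z)"
    by simp
  from has_derivative_unique[OF this has_derivative_const]
  have "(\<lambda>v. ctranspose (U z) ** frechet_derivative U (at z) v +
      ctranspose (frechet_derivative U (at z) v) ** U z) = (\<lambda>v. 0)" .
  from fun_cong[OF this, of v] show ?thesis
    by (simp add: ctranspose_mult eq_neg_iff_add_eq_0 add.commute)
qed

text \<open>The form U^* dU is real-linear with skew-Hermitian values, so its dzbar part is minus
  the adjoint of its dz part, and one coefficient carries everything.\<close>

lemma A_z_A_zbar:
  shows A_zbar_eq: "A_zbar U z = - ctranspose (A_z U z)"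
    and frechet_derivative_A_z:
      "frechet_derivative U (at z) v = 2 *\<^sub>M (U z ** (v *\<^sub>M A_z U z - cnj v *\<^sub>M ctranspose (A_z U z)))"
proof -
  define D where "D = frechet_derivative U (at z)"
  define M where "M v = ctranspose (U z) ** D v" for v
  have linear: "linear D"
    using diff unfolding D_def by (rule linear_frechet_derivative)
  have M: "M v = of_real (Re v) *\<^sub>M M 1 + of_real (Im v) *\<^sub>M M \<i>"
  proof -
    have "D v = D (Re v *\<^sub>R 1 + Im v *\<^sub>R \<i>)"
      by (rule arg_cong[of _ _ D]) (simp add: complex_eq_iff)
    also have "\<dots> = of_real (Re v) *\<^sub>M D 1 + of_real (Im v) *\<^sub>M D \<i>"
      using linear by (simp only: linear_add linear_cmul cscale_of_real)
    finally show ?thesis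
      by (simp add: M_def matrix_mul_distribs)
  qed
  have skew: "ctranspose (M v) = - M v" for v
    unfolding M_def D_def by (rule skew_hermitian)
  have A: "A_z U z = (1/4) *\<^sub>M (M 1 - \<i> *\<^sub>M M \<i>)" "A_zbar U z = (1/4) *\<^sub>M (M 1 + \<i> *\<^sub>M M \<i>)"
    by (simp_all add: A_z_def A_zbar_def wirtinger_z_def wirtinger_zbar_def M_def D_def matrix_mul_distribs
        unitary_matrix_inv[OF unitary])
  show "A_zbar U z = - ctranspose (A_z U z)"
    by (simp add: A skew cscale_distribs)
  have "2 *\<^sub>M (v *\<^sub>M A_z U z - cnj v *\<^sub>M ctranspose (A_z U z)) = M v"
    unfolding M A by (simp add: skew cscale_distribs) (simp add: vec_eq_iff complex_eq_iff field_simps)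
  then have "2 *\<^sub>M (U z ** (v *\<^sub>M A_z U z - cnj v *\<^sub>M ctranspose (A_z U z))) = U z ** M v"
    by (metis cscale_mult_right)
  also have "\<dots> = D v"
    using unitary[of z] by (simp add: M_def matrix_mul_assoc unitary_group_def)
  finally show "D v = 2 *\<^sub>M (U z ** (v *\<^sub>M A_z U z - cnj v *\<^sub>M ctranspose (A_z U z)))" ..
qed

end

lemma A_z_differentiable:
  fixes U :: "complex \<Rightarrow> complex^'n^'n"
  assumes "\<And>x. U x \<in> unitary_group" "smooth_on UNIV U"
  shows "A_z U differentiable (at z)"
proof -
  define G where "G x = (1/4) *\<^sub>M (ctranspose (U x) **
      (frechet_derivative U (at x) 1 - \<i> *\<^sub>M frechet_derivative U (at x) \<i>))" for x
  have "A_z U = G"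
    by (simp add: fun_eq_iff A_z_def wirtinger_z_def unitary_matrix_inv[OF assms(1)] G_def)
  moreover have "(G has_derivative (\<lambda>v. (1/4) *\<^sub>M (ctranspose (U z) **
      (frechet_derivative (\<lambda>x. frechet_derivative U (at x) 1) (at z) v -
        \<i> *\<^sub>M frechet_derivative (\<lambda>x. frechet_derivative U (at x) \<i>) (at z) v) +
      ctranspose (frechet_derivative U (at z) v) **
      (frechet_derivative U (at z) 1 - \<i> *\<^sub>M frechet_derivative U (at z) \<i>)))) (at z)"
    unfolding G_def
    by (intro bounded_linear.has_derivative[OF bounded_linear_cscale] matrix_mult_has_derivative
        ctranspose_has_derivative has_derivative_diff smooth_has_derivative smooth_frechet_derivative assms)
  then have "G differentiable (at z)"
    by (rule differentiableI)
  ultimately show ?thesis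
    by simp
qed

text \<open>The zero-curvature equation for F^{-1} dF, obtained by equating the mixed second
  derivatives of \<open>F\<close> in the directions 1 and \<i>. The combination of
  \<open>A' 1\<close> and \<open>A' \<i>\<close> is twice the zbar-derivative of
  \<open>A\<close>.\<close>

lemma flatness:
  fixes F A :: "complex \<Rightarrow> complex^'n^'n"
  assumes F: "smooth_on UNIV F" and unitary: "F z \<in> unitary_group"
    and A: "(A has_derivative A') (at z)"
    and eq: "\<And>x v. frechet_derivative F (at x) v = F x ** ((a * v) *\<^sub>M A x - (b * cnj v) *\<^sub>M ctranspose (A x))"
  shows "a *\<^sub>M (A' 1 + \<i> *\<^sub>M A' \<i>) + b *\<^sub>M ctranspose (A' 1 + \<i> *\<^sub>M A' \<i>) =
    (2 * a * b) *\<^sub>M (ctranspose (A z) ** A z - A z ** ctranspose (A z))"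
proof -
  define X where "X v x = (a * v) *\<^sub>M A x - (b * cnj v) *\<^sub>M ctranspose (A x)" for v x
  have F': "(F has_derivative (\<lambda>w. F z ** X w z)) (at z)"
  proof -
    have "frechet_derivative F (at z) = (\<lambda>w. F z ** X w z)"
      unfolding X_def by (rule ext) (rule eq)
    then show ?thesis
      using smooth_has_derivative[OF F, of z] by simp
  qed
  have "((\<lambda>x. F x ** X v x) has_derivative (\<lambda>w. F z ** ((a * v) *\<^sub>M A' w - (b * cnj v) *\<^sub>M ctranspose (A' w)) +
      (F z ** X w z) ** X v z)) (at z)" for v
    by (rule matrix_mult_has_derivative[OF F']) (unfold X_def, intro has_derivative_diff A
        ctranspose_has_derivative bounded_linear.has_derivative[OF bounded_linear_cscale])
  note FX = frechet_derivative_at[OF this, symmetric]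
  have "frechet_derivative (\<lambda>x. frechet_derivative F (at x) v) (at z) w =
      F z ** ((a * v) *\<^sub>M A' w - (b * cnj v) *\<^sub>M ctranspose (A' w)) + (F z ** X w z) ** X v z" for v w
    unfolding eq X_def[symmetric] FX ..
  then have D: "ctranspose (F z) ** frechet_derivative (\<lambda>x. frechet_derivative F (at x) v) (at z) w =
      ((a * v) *\<^sub>M A' w - (b * cnj v) *\<^sub>M ctranspose (A' w)) + X w z ** X v z" for v w
    using unitary by (simp add: matrix_mul_distribs matrix_mul_assoc unitary_group_def)
  have "((a * 1) *\<^sub>M A' \<i> - (b * cnj 1) *\<^sub>M ctranspose (A' \<i>)) + X \<i> z ** X 1 z =
      ((a * \<i>) *\<^sub>M A' 1 - (b * cnj \<i>) *\<^sub>M ctranspose (A' 1)) + X 1 z ** X \<i> z"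
    unfolding D[symmetric] frechet_derivative_commute[OF F, of 1] ..
  then have "\<i> *\<^sub>M (((a * 1) *\<^sub>M A' \<i> - (b * cnj 1) *\<^sub>M ctranspose (A' \<i>)) + X \<i> z ** X 1 z) =
      \<i> *\<^sub>M (((a * \<i>) *\<^sub>M A' 1 - (b * cnj \<i>) *\<^sub>M ctranspose (A' 1)) + X 1 z ** X \<i> z)"
    by simp
  then show ?thesis
    by (simp add: X_def matrix_mul_distribs cscale_distribs) (simp add: vec_eq_iff algebra_simps)
qed

text \<open>Flatness gives the commutator [A^*, A] as the zbar-derivative of \<open>A\<close>, and
  the trace of A [A^*, A] vanishes by cyclicity.\<close>

lemma quadratic_differential_holomorphic:
  fixes A :: "complex \<Rightarrow> complex^'n^'n" and F :: "complex \<Rightarrow> complex \<Rightarrow> complex^'n^'n"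
  assumes A: "\<And>z. A differentiable (at z)"
    and F: "\<And>\<zeta>. \<zeta> \<in> sphere 0 1 \<Longrightarrow> smooth_on UNIV (F \<zeta>)"
    and unitary: "\<And>\<zeta> z. \<zeta> \<in> sphere 0 1 \<Longrightarrow> F \<zeta> z \<in> unitary_group"
    and eq: "\<And>\<zeta> x v. \<zeta> \<in> sphere 0 1 \<Longrightarrow> frechet_derivative (F \<zeta>) (at x) v =
      F \<zeta> x ** (((1 - inverse \<zeta>) * v) *\<^sub>M A x - ((1 - \<zeta>) * cnj v) *\<^sub>M ctranspose (A x))"
  shows "(\<lambda>z. trace (A z ** A z)) holomorphic_on UNIV"
proof -
  have "(\<lambda>z. trace (A z ** A z)) field_differentiable (at z)" for z
  proof -
    define A' where "A' = frechet_derivative A (at z)"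
    have A': "(A has_derivative A') (at z)"
      using A by (simp add: A'_def frechet_derivative_works)
    define P where "P = A' 1 + \<i> *\<^sub>M A' \<i>"
    define C where "C = ctranspose (A z) ** A z - A z ** ctranspose (A z)"
    \<comment> \<open>The parameters -1 and \<i> give (a, b) = (2, 2) and (1 + \<i>, 1 - \<i>), two
      independent equations for \<open>P\<close> and its adjoint.\<close>
    have "2 *\<^sub>M P + 2 *\<^sub>M ctranspose P = 8 *\<^sub>M C"
      using flatness[OF F[of "-1"] unitary[of "-1"] A' eq[of "-1"]] by (simp add: P_def C_def)
    moreover have "(1 + \<i>) *\<^sub>M P + (1 - \<i>) *\<^sub>M ctranspose P = 4 *\<^sub>M C"
      using flatness[OF F[of \<i>] unitary[of \<i>] A' eq[of \<i>]] by (simp add: P_def C_def algebra_simps)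
    ultimately have "P = 2 *\<^sub>M C"
      by (simp add: vec_eq_iff complex_eq_iff algebra_simps) (smt (verit, best))
    then have "trace (A z ** P) = 2 * (trace (A z ** (ctranspose (A z) ** A z)) - trace (A z ** (A z ** ctranspose (A z))))"
      by (simp add: C_def matrix_mul_distribs trace_sub)
    also have "trace (A z ** (ctranspose (A z) ** A z)) = trace (A z ** (A z ** ctranspose (A z)))"
      by (subst trace_mul_sym) (simp add: matrix_mul_assoc trace_mul_sym[of "ctranspose (A z)"])
    finally have P: "trace (A z ** P) = 0"
      by simp
    have lin: "linear A'"
      using A' by (rule has_derivative_linear)
    have "((\<lambda>z. trace (A z ** A z)) has_derivative (\<lambda>w. trace (A z ** A' w + A' w ** A z))) (at z)"
      by (intro bounded_linear.has_derivative[OF bounded_linear_trace] matrix_mult_has_derivative A')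
    moreover have "trace (A z ** A' w + A' w ** A z) = (2 * trace (A z ** A' 1)) * w" for w
    proof -
      have "A' w = A' (Re w *\<^sub>R 1 + Im w *\<^sub>R \<i>)"
        by (rule arg_cong[of _ _ A']) (simp add: complex_eq_iff)
      also have "\<dots> = of_real (Re w) *\<^sub>M A' 1 + of_real (Im w) *\<^sub>M A' \<i>"
        using lin by (simp only: linear_add linear_cmul cscale_of_real)
      \<comment> \<open>Splits off the complex-linear part; the rest is a multiple of
        \<open>P\<close>, which the trace against \<open>A z\<close> annihilates.\<close>
      also have "\<dots> = w *\<^sub>M A' 1 - (\<i> * of_real (Im w)) *\<^sub>M P"
        by (simp add: P_def vec_eq_iff complex_eq_iff algebra_simps)
      finally have "trace (A z ** A' w) = w * trace (A z ** A' 1)"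
        by (simp add: matrix_mul_distribs trace_sub P)
      then show ?thesis
        by (simp add: trace_add trace_mul_sym[of "A' w"])
    qed
    ultimately have "((\<lambda>z. trace (A z ** A z)) has_field_derivative 2 * trace (A z ** A' 1)) (at z)"
      by (simp add: has_field_derivative_def)
    then show ?thesis
      by (auto simp: field_differentiable_def)
  qed
  then show ?thesis
    by (simp add: holomorphic_on_def)
qed

text \<open>A_z dz is a (1,0)-form, so it picks up the derivative -1 / z^2 of the coordinate
  change.\<close>

lemma A_z_chart_change:
  fixes U V :: "complex \<Rightarrow> complex^'n^'n"
  assumes unitary: "\<And>x. U x \<in> unitary_group" "\<And>x. V x \<in> unitary_group"
    and diff: "\<And>z. V differentiable (at z)"
    and UV: "\<And>x. x \<noteq> 0 \<Longrightarrow> U x = V (1 / x)" and z: "z \<noteq> 0"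
  shows "A_z U z = (- 1 / z\<^sup>2) *\<^sub>M A_z V (1 / z)"
proof (rule A_z_eqI[OF unitary(1)])
  fix v
  let ?B = "A_z V (1 / z)"
  have "((\<lambda>x. 1 / x) has_derivative (\<lambda>v. - 1 / z\<^sup>2 * v)) (at z)"
    using z by (auto intro!: derivative_eq_intros simp: power2_eq_square field_simps)
  from has_derivative_compose[OF this, of V "frechet_derivative V (at (1 / z))"]
  have "((\<lambda>x. V (1 / x)) has_derivative (\<lambda>v. frechet_derivative V (at (1 / z)) (- 1 / z\<^sup>2 * v))) (at z)"
    using diff by (simp add: frechet_derivative_works)
  then have "(U has_derivative (\<lambda>v. frechet_derivative V (at (1 / z)) (- 1 / z\<^sup>2 * v))) (at z)"
    by (rule has_derivative_transform_within_open[of _ _ _ _ "- {0}"]) (use z UV in auto)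
  then have "frechet_derivative U (at z) v = frechet_derivative V (at (1 / z)) (- 1 / z\<^sup>2 * v)"
    by (metis frechet_derivative_at)
  then show "frechet_derivative U (at z) v =
      2 *\<^sub>M (U z ** (v *\<^sub>M (- 1 / z\<^sup>2) *\<^sub>M ?B - cnj v *\<^sub>M ctranspose ((- 1 / z\<^sup>2) *\<^sub>M ?B)))"
    unfolding frechet_derivative_A_z[OF unitary(2) diff] UV[OF z] by (simp add: mult.commute)
qed

text \<open>The fourth power is the square of the factor for dz. Regularity at infinity thus forces
  decay in the finite chart, and Liouville's theorem applies.\<close>

lemma quadratic_differential_zero:
  assumes hol: "f holomorphic_on UNIV" and cont: "isCont g 0"
    and fg: "\<And>z. z \<noteq> 0 \<Longrightarrow> f z = g (1 / z) / z ^ 4"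
  shows "f z = (0 :: complex)"
proof (rule Liouville_weak_0[OF hol])
  have "((\<lambda>z. g (inverse z) * inverse z ^ 4) \<longlongrightarrow> g 0 * 0 ^ 4) at_infinity"
    by (intro tendsto_mult tendsto_power tendsto_inverse_0 isCont_tendsto_compose[OF cont])
  moreover have "\<forall>\<^sub>F z in at_infinity. g (inverse z) * inverse z ^ 4 = f z"
    unfolding eventually_at_infinity
    by (rule exI[of _ 1], auto) (subst fg, auto simp: divide_simps)
  ultimately show "(f \<longlongrightarrow> 0) at_infinity"
    by (simp add: tendsto_cong)
qed

section \<open>The coefficients of a polynomial extended solution\<close>

lemma root_of_unity_sum:
  fixes m :: int
  assumes "\<bar>m\<bar> < int N"
  shows "(\<Sum>s<N. cis (2 * pi * of_int m / N) ^ s) = (if m = 0 then of_nat N else 0)"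
proof (cases "m = 0")
  case False
  have N: "N > 0"
    using assms by linarith
  have "cis (2 * pi * of_int m / N) \<noteq> 1"
  proof
    assume "cis (2 * pi * of_int m / N) = 1"
    then have "cos (2 * pi * of_int m / N) = 1"
      by (simp add: complex_eq_iff)
    then obtain l :: int where "2 * pi * of_int m / N = of_int l * 2 * pi"
      using cos_one_2pi_int by blast
    then have "of_int m = of_int l * real N"
      using N by (simp add: field_simps)
    then have m: "m = l * int N"
      by (metis of_int_eq_iff of_int_mult of_int_of_nat_eq)
    then have "\<bar>l\<bar> * int N < 1 * int N"
      using assms by (simp add: abs_mult)
    then have "\<bar>l\<bar> < 1"
      using mult_less_cancel_right_disj[of "\<bar>l\<bar>" "int N" 1] by linarith
    then show False
      using m False by simp
  qed
  moreover have "cis (2 * pi * of_int m / N) ^ N = 1"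
    using N cis_multiple_2pi[of "of_int m"] by (simp add: Complex.DeMoivre)
  ultimately show ?thesis
    using False by (simp add: geometric_sum)
qed simp

text \<open>Discrete Fourier inversion: coefficients become finite combinations of values of the
  loop and inherit differentiability in z without differentiating under an integral. Degrees from 0
  to r differ by at most r, so roots of unity of order r + 1 separate them.\<close>

lemma coefficient_interpolation:
  fixes T :: "int \<Rightarrow> complex^'n^'m" and r :: nat
  assumes "\<And>z. z \<in> sphere 0 1 \<Longrightarrow> \<gamma> z = (\<Sum>k=0..int r. z powi k *\<^sub>M T k)" and j: "j \<in> {0..int r}"
  shows "T j = (\<Sum>s<Suc r. (cis (- (2 * pi * j * s / Suc r)) / Suc r) *\<^sub>M \<gamma> (cis (2 * pi * s / Suc r)))"
proof -
  let ?w = "\<lambda>s. cis (- (2 * pi * j * s / Suc r)) / Suc r"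
  have weight: "(\<Sum>s<Suc r. ?w s * cis (2 * pi * s / Suc r) powi k) = (if k = j then 1 else 0)"
    if "k \<in> {0..int r}" for k
  proof -
    have "?w s * cis (2 * pi * s / Suc r) powi k = cis (2 * pi * of_int (k - j) / Suc r) ^ s / Suc r" for s
      unfolding cis_power_int Complex.DeMoivre times_divide_eq_left cis_mult
      by (intro arg_cong2[where f = "(/)"] arg_cong[where f = cis] refl)
        (simp add: diff_divide_distrib algebra_simps)
    then have "(\<Sum>s<Suc r. ?w s * cis (2 * pi * s / Suc r) powi k) =
        (\<Sum>s<Suc r. cis (2 * pi * of_int (k - j) / Suc r) ^ s) / Suc r"
      by (simp only: sum_divide_distrib)
    also have "\<dots> = (if k = j then 1 else 0)"
      using that j by (subst root_of_unity_sum) (auto simp del: of_nat_Suc)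
    finally show ?thesis .
  qed
  have "(\<Sum>s<Suc r. ?w s *\<^sub>M \<gamma> (cis (2 * pi * s / Suc r))) =
      (\<Sum>s<Suc r. \<Sum>k=0..int r. (?w s * cis (2 * pi * s / Suc r) powi k) *\<^sub>M T k)"
    using assms(1) by (simp add: cscale_sum_right del: of_nat_Suc sum.lessThan_Suc)
  also have "\<dots> = (\<Sum>k=0..int r. (\<Sum>s<Suc r. ?w s * cis (2 * pi * s / Suc r) powi k) *\<^sub>M T k)"
    by (subst sum.swap) (simp only: vec_eq_iff sum_nth2 cscale_nth sum_distrib_right, simp)
  also have "\<dots> = (\<Sum>k=0..int r. if k = j then T j else 0)"
    by (intro sum.cong refl, subst weight) auto
  also have "\<dots> = T j"
    using j by simp
  finally show ?thesis ..
qed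

text \<open>The factors 1 - 1/\<zeta> and 1 - \<zeta> become the index differences T_k - T_{k+1} and
  T_k - T_{k-1}. They also produce degrees -1 and r + 1, where the derivative of the loop has no
  term; these degrees give the two vanishing products.\<close>

lemma coefficient_derivative:
  fixes \<Gamma> :: "complex \<Rightarrow> complex \<Rightarrow> complex^'n^'n"
  assumes loop: "\<And>x. unitary_polynomial_loop (\<Gamma> x) (T x) r"
    and der: "\<And>\<zeta>. \<zeta> \<in> sphere 0 1 \<Longrightarrow> ((\<lambda>x. \<Gamma> x \<zeta>) has_derivative
      (\<lambda>v. \<Gamma> z \<zeta> ** (((1 - inverse \<zeta>) * v) *\<^sub>M A - ((1 - \<zeta>) * cnj v) *\<^sub>M ctranspose A))) (at z)"
  shows coefficient_has_derivative: "((\<lambda>x. T x k) has_derivative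
      (\<lambda>v. v *\<^sub>M ((T z k - T z (k + 1)) ** A) - cnj v *\<^sub>M ((T z k - T z (k - 1)) ** ctranspose A))) (at z)"
    and lowest_coefficient: "T z 0 ** A = 0"
    and highest_coefficient: "T z (int r) ** ctranspose A = 0"
proof -
  interpret unitary_polynomial_loop "\<Gamma> x" "T x" r for x
    by (rule loop)
  have "(\<lambda>x. T x k) differentiable (at z)" for k
  proof (cases "k \<in> {0..int r}")
    case True
    have eq: "(\<lambda>x. T x k) = (\<lambda>x. \<Sum>s<Suc r. (cis (- (2 * pi * k * s / Suc r)) / Suc r) *\<^sub>M \<Gamma> x (cis (2 * pi * s / Suc r)))"
      using coefficient_interpolation[OF expansion True] by (rule ext)
    have "(\<lambda>x. c *\<^sub>M \<Gamma> x (cis t)) differentiable (at z)" for c t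
      by (rule differentiableI) (rule bounded_linear.has_derivative[OF bounded_linear_cscale der], simp)
    then show ?thesis
      by (subst eq) (rule differentiable_sum[OF finite_lessThan], blast)
  next
    case False
    then show ?thesis
      by (simp add: supp)
  qed
  then obtain T' where T': "\<And>k. ((\<lambda>x. T x k) has_derivative T' k) (at z)"
    unfolding differentiable_def by metis
  have T'_0: "T' k = (\<lambda>v. 0)" if "k \<notin> {0..int r}" for k
    using T'[of k] that by (intro has_derivative_unique[of "\<lambda>x. T x k"]) (simp_all add: supp)
  \<comment> \<open>One index more on either side than the support, to hold the degrees produced by
    1/\<zeta> and \<zeta>.\<close>
  define K where "K = {-1..int r + 1}"
  define E where "E k v = T' k v -
    (v *\<^sub>M ((T z k - T z (k + 1)) ** A) - cnj v *\<^sub>M ((T z k - T z (k - 1)) ** ctranspose A))" for k v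
  have E_0: "E k v = 0" for k v
  proof (cases "k \<in> K")
    case True
    show ?thesis
    proof (rule laurent_unique_matrix[of K "\<lambda>k. E k v"])
      fix \<zeta> :: complex assume \<zeta>: "\<zeta> \<in> sphere 0 1"
      have shift: "(\<Sum>k\<in>K. \<zeta> powi k *\<^sub>M T z (k + d)) = \<zeta> powi (- d) *\<^sub>M \<Gamma> z \<zeta>" if "\<bar>d\<bar> \<le> 1" for d
      proof -
        have "(\<Sum>k\<in>K. \<zeta> powi k *\<^sub>M T z (k + d)) = (\<Sum>k=-d..int r - d. \<zeta> powi k *\<^sub>M T z (k + d))"
          using that by (intro sum.mono_neutral_right) (auto simp: K_def supp)
        also have "\<dots> = (\<Sum>k=0..int r. \<zeta> powi (k - d) *\<^sub>M T z k)"
          by (rule sum.reindex_bij_witness[of _ "\<lambda>k. k - d" "\<lambda>k. k + d"]) auto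
        also have "\<dots> = \<zeta> powi (- d) *\<^sub>M \<Gamma> z \<zeta>"
          using powi_add[OF \<zeta>, of _ "- d"] expansion[OF \<zeta>] by (simp add: cscale_sum_right mult.commute)
        finally show ?thesis .
      qed
      have "((\<lambda>x. \<Sum>k=0..int r. \<zeta> powi k *\<^sub>M T x k) has_derivative
          (\<lambda>v. \<Sum>k=0..int r. \<zeta> powi k *\<^sub>M T' k v)) (at z)"
        by (intro has_derivative_sum bounded_linear.has_derivative[OF bounded_linear_cscale] T')
      then have "((\<lambda>x. \<Gamma> x \<zeta>) has_derivative (\<lambda>v. \<Sum>k=0..int r. \<zeta> powi k *\<^sub>M T' k v)) (at z)"
        using expansion[OF \<zeta>] by simp
      from fun_cong[OF has_derivative_unique[OF this der[OF \<zeta>]], of v]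
      have "(\<Sum>k\<in>K. \<zeta> powi k *\<^sub>M T' k v) =
          \<Gamma> z \<zeta> ** (((1 - inverse \<zeta>) * v) *\<^sub>M A - ((1 - \<zeta>) * cnj v) *\<^sub>M ctranspose A)"
        by (subst sum.mono_neutral_right[of _ "{0..int r}"]) (auto simp: K_def T'_0)
      moreover have "(\<Sum>k\<in>K. \<zeta> powi k *\<^sub>M ((T z k - T z (k + d)) ** B)) =
          (1 - \<zeta> powi (- d)) *\<^sub>M (\<Gamma> z \<zeta> ** B)" if "\<bar>d\<bar> \<le> 1" for d and B :: "complex^'n^'n"
      proof -
        have "(\<Sum>k\<in>K. \<zeta> powi k *\<^sub>M ((T z k - T z (k + d)) ** B)) =
            ((\<Sum>k\<in>K. \<zeta> powi k *\<^sub>M T z (k + 0)) - (\<Sum>k\<in>K. \<zeta> powi k *\<^sub>M T z (k + d))) ** B"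
          by (simp add: matrix_mul_distribs matrix_mul_sum_left cscale_distribs sum_subtractf)
        then show ?thesis
          using shift[of 0] shift[OF that] by (simp add: cscale_distribs matrix_mul_distribs)
      qed
      from this[of 1 A] this[of "-1" "ctranspose A"]
      have "(\<Sum>k\<in>K. \<zeta> powi k *\<^sub>M ((T z k - T z (k + 1)) ** A)) = (1 - inverse \<zeta>) *\<^sub>M (\<Gamma> z \<zeta> ** A)"
        "(\<Sum>k\<in>K. \<zeta> powi k *\<^sub>M ((T z k - T z (k - 1)) ** ctranspose A)) = (1 - \<zeta>) *\<^sub>M (\<Gamma> z \<zeta> ** ctranspose A)"
        by (simp_all add: power_int_minus)
      moreover have "(\<Sum>k\<in>K. \<zeta> powi k *\<^sub>M E k v) = (\<Sum>k\<in>K. \<zeta> powi k *\<^sub>M T' k v) -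
          (v *\<^sub>M (\<Sum>k\<in>K. \<zeta> powi k *\<^sub>M ((T z k - T z (k + 1)) ** A)) -
           cnj v *\<^sub>M (\<Sum>k\<in>K. \<zeta> powi k *\<^sub>M ((T z k - T z (k - 1)) ** ctranspose A)))"
        unfolding E_def by (simp add: cscale_diff_right sum_subtractf cscale_sum_right mult.commute)
      ultimately show "(\<Sum>k\<in>K. \<zeta> powi k *\<^sub>M E k v) = 0"
        by (simp add: matrix_mul_distribs mult.commute)
    qed (use True in \<open>auto simp: K_def\<close>)
  next
    case False
    then have "k \<notin> {0..int r}" "k + 1 \<notin> {0..int r}" "k - 1 \<notin> {0..int r}"
      by (auto simp: K_def)
    note out = supp[OF this(1)] supp[OF this(2)] supp[OF this(3)] T'_0[OF this(1)]
    show ?thesis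
      unfolding E_def out by simp
  qed
  have "T' k = (\<lambda>v. v *\<^sub>M ((T z k - T z (k + 1)) ** A) - cnj v *\<^sub>M ((T z k - T z (k - 1)) ** ctranspose A))"
    using E_0[of k] by (simp add: E_def fun_eq_iff)
  then show "((\<lambda>x. T x k) has_derivative
      (\<lambda>v. v *\<^sub>M ((T z k - T z (k + 1)) ** A) - cnj v *\<^sub>M ((T z k - T z (k - 1)) ** ctranspose A))) (at z)"
    using T'[of k] by simp
  show "T z 0 ** A = 0"
    using E_0[of "-1" 1] by (simp add: E_def T'_0 supp)
  show "T z (int r) ** ctranspose A = 0"
    using E_0[of "int r + 1" 1] by (simp add: E_def T'_0 supp)
qed

lemma sum_UNIV_prod: "(\<Sum>p\<in>UNIV. f p) = (\<Sum>a\<in>UNIV. \<Sum>b\<in>UNIV. f (a, b))"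
  by (simp add: sum.cartesian_product flip: UNIV_Times_UNIV)

context unitary_polynomial_loop
begin

text \<open>The adjoint loop is the inverse, so membership means that \<gamma>^* v has no negative
  Fourier modes. Its coefficient of degree m pairs v with the block column of index m, which leads
  to \<open>kern\<close>.\<close>

lemma poly_of_vec_mem_iff:
  fixes deg :: "'r::finite \<Rightarrow> nat"
  assumes deg: "bij_betw deg UNIV {..<r}"
  shows "poly_of_vec deg v \<in> loop_image \<gamma> H_plus \<longleftrightarrow> block_proj deg r T *v v = v"
proof -
  interpret P: unitary_polynomial T r deg
    using deg by (rule unitary_polynomial)
  define c where "c i m = (ctranspose (block_col deg T m) *v v) $ i" for i m
  have cont: "continuous_on (sphere 0 1) (poly_of_vec deg v)"
    unfolding poly_of_vec_def by (intro continuous_on_vec_lambda continuous_intros)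
  have expand: "(ctranspose (\<gamma> z) *v poly_of_vec deg v z) $ i = (\<Sum>m=-int r..int r. c i m * z powi m)"
    if z: "z \<in> sphere 0 1" for z i
  proof -
    have block: "cnj (\<gamma> z $ l $ i) * z ^ deg a = (\<Sum>m=-int r..int r. z powi m * cnj (T (int (deg a) - m) $ l $ i))"
      for l a
    proof -
      have "cnj (\<gamma> z $ l $ i) = (\<Sum>k=0..int r. z powi (- k) * cnj (T k $ l $ i))"
        using arg_cong[OF ctranspose_expansion[OF z], of "\<lambda>M. M $ i $ l"] by simp
      then have "cnj (\<gamma> z $ l $ i) * z ^ deg a = (\<Sum>k=0..int r. z powi (int (deg a) - k) * cnj (T k $ l $ i))"
        using powi_add[OF z, of "int (deg a)" "- _"] by (simp add: sum_distrib_left mult_ac)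
      also have "\<dots> = (\<Sum>m=int (deg a) - int r..int (deg a). z powi m * cnj (T (int (deg a) - m) $ l $ i))"
        by (rule sum.reindex_bij_witness[of _ "\<lambda>m. int (deg a) - m" "\<lambda>k. int (deg a) - k"]) auto
      also have "\<dots> = (\<Sum>m=-int r..int r. z powi m * cnj (T (int (deg a) - m) $ l $ i))"
        using P.deg_less[of a] by (intro sum.mono_neutral_left) (auto simp: supp)
      finally show ?thesis .
    qed
    have "(ctranspose (\<gamma> z) *v poly_of_vec deg v z) $ i =
        (\<Sum>l\<in>UNIV. \<Sum>a\<in>UNIV. cnj (\<gamma> z $ l $ i) * z ^ deg a * v $ (a, l))"
      by (simp add: matrix_vector_mult_def poly_of_vec_def sum_distrib_left mult.assoc)
    also have "\<dots> = (\<Sum>a\<in>UNIV. \<Sum>l\<in>UNIV. \<Sum>m=-int r..int r.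
        z powi m * cnj (T (int (deg a) - m) $ l $ i) * v $ (a, l))"
      unfolding block sum_distrib_right by (rule sum.swap)
    also have "\<dots> = (\<Sum>p\<in>UNIV. \<Sum>m=-int r..int r.
        z powi m * cnj (T (int (deg (fst p)) - m) $ snd p $ i) * v $ p)"
      by (simp add: sum_UNIV_prod)
    also have "\<dots> = (\<Sum>m=-int r..int r. \<Sum>p\<in>UNIV.
        z powi m * cnj (T (int (deg (fst p)) - m) $ snd p $ i) * v $ p)"
      by (rule sum.swap)
    also have "\<dots> = (\<Sum>m=-int r..int r. c i m * z powi m)"
      by (simp add: c_def matrix_vector_mult_def block_col_nth sum_distrib_left sum_distrib_right mult_ac)
    finally show ?thesis .
  qed
  have coeff: "circle_coeff (\<lambda>z. (ctranspose (\<gamma> z) *v poly_of_vec deg v z) $ i) k =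
      (if - k \<in> {-int r..int r} then 2 * pi * c i (- k) else 0)" for i k
    using expand by (subst circle_coeff_cong[where g = "\<lambda>z. \<Sum>m=-int r..int r. c i m * z powi m"])
      (auto simp: circle_coeff_laurent)
  have "poly_of_vec deg v \<in> loop_image \<gamma> H_plus \<longleftrightarrow>
      (\<forall>k>0. \<forall>i. circle_coeff (\<lambda>z. (ctranspose (\<gamma> z) *v poly_of_vec deg v z) $ i) k = 0)"
    by (simp only: loop_image_iff[OF cont] H_plus_continuous[OF continuous_mult(2)[OF cont]])
  also have "\<dots> \<longleftrightarrow> (\<forall>m\<in>{-int r..-1}. \<forall>i. c i m = 0)"
  proof
    assume *: "\<forall>k>0. \<forall>i. circle_coeff (\<lambda>z. (ctranspose (\<gamma> z) *v poly_of_vec deg v z) $ i) k = 0"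
    show "\<forall>m\<in>{-int r..-1}. \<forall>i. c i m = 0"
    proof (intro ballI allI)
      fix m i assume m: "m \<in> {-int r..-1}"
      then have "circle_coeff (\<lambda>z. (ctranspose (\<gamma> z) *v poly_of_vec deg v z) $ i) (- m) = 0"
        using * by simp
      then show "c i m = 0"
        using m by (simp add: coeff)
    qed
  qed (auto simp: coeff)
  also have "\<dots> \<longleftrightarrow> v \<in> P.kern"
    by (simp add: P.kern_def c_def vec_eq_iff)
  finally show ?thesis
    by (simp add: P.kern_iff)
qed

end

section \<open>Filling out zeros\<close>

lemma sphere_charts_surj:
  obtains c z where "c \<in> sphere_charts" "c z = p"
proof (cases p)
  case (Finite_Point x)
  then show ?thesis
    using that[of chart_zero x] by (simp add: sphere_charts_def chart_zero_def)
next
  case Infinity_Point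
  then show ?thesis
    using that[of chart_infinity 0] by (simp add: sphere_charts_def chart_infinity_def)
qed

lemma inj_sphere_chart: "c \<in> sphere_charts \<Longrightarrow> inj c"
  by (auto simp: sphere_charts_def chart_zero_def chart_infinity_def inj_def split: if_splits)

text \<open>A continuous family of projections has locally constant rank, so the range at an exceptional point
  has the same dimension as the limit space it contains.\<close>

lemma holomorphic_extension_range:
  fixes X :: "riemann_sphere \<Rightarrow> (complex^'m) set"
  assumes X: "holomorphic_to_grassmannian k X" and "finite F"
    and generic: "\<And>p. p \<notin> F \<Longrightarrow> X p = {v. Q p *v v = v}"
    and cont: "\<And>c. c \<in> sphere_charts \<Longrightarrow> continuous_on UNIV (\<lambda>z. Q (c z))"
    and idem: "\<And>p. Q p ** Q p = Q p"
  shows "X p = {v. Q p *v v = v}"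
proof -
  obtain c z0 where c: "c \<in> sphere_charts" and p: "c z0 = p"
    by (rule sphere_charts_surj)
  have "finite (c -` F)"
    using \<open>finite F\<close> inj_sphere_chart[OF c] by (intro finite_vimageI)
  then have "closed (c -` F - {z0})"
    by (intro finite_imp_closed) auto
  then have "open (- (c -` F - {z0}))"
    by (rule open_Compl)
  then have ev_F: "eventually (\<lambda>z. c z \<notin> F) (at z0)"
    unfolding eventually_at_topological by (intro exI[of _ "- (c -` F - {z0})"]) auto
  obtain K where K: "\<And>(A :: complex^'m^'m) x. norm (A *v x) \<le> norm A * norm x * K" "K > 0"
    using bounded_bilinear.pos_bounded[of "(*v) :: complex^'m^'m \<Rightarrow> _"]
    by (metis bounded_bilinear_matrix_vector_mult)
  have Q0: "((\<lambda>z. Q (c z)) \<longlongrightarrow> Q p) (at z0)"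
    using cont[OF c] p by (auto simp: continuous_on_def)
  obtain U s where U: "open U" "z0 \<in> U" and "\<forall>i<k. \<forall>a. (\<lambda>z. s i z $ a) holomorphic_on U"
    and "\<forall>z\<in>U. X (c z) = vec.span ((\<lambda>i. s i z) ` {..<k})"
    using X[unfolded holomorphic_to_grassmannian_def, THEN conjunct2, THEN bspec, OF c, THEN spec, of z0]
    by (elim exE conjE)
  then have hol: "\<And>i a. i < k \<Longrightarrow> (\<lambda>z. s i z $ a) holomorphic_on U"
    and span: "\<And>z. z \<in> U \<Longrightarrow> X (c z) = vec.span ((\<lambda>i. s i z) ` {..<k})"
    by blast+
  have ev_U: "eventually (\<lambda>z. z \<in> U) (at z0)"
    using U unfolding eventually_at_topological by blast
  let ?R = "\<lambda>p. {v. Q p *v v = v}"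
  have sub: "vec.subspace (?R p)" for p
    by (simp add: vec.subspace_def matrix_vector_right_distrib vector_scalar_commute)
  have dim_X: "vec.dim (X p) = k" "vec.subspace (X p)" for p
    using X by (auto simp: holomorphic_to_grassmannian_def grassmannian_def)
  \<comment> \<open>By continuity the limit of the frame is still fixed by \<open>Q\<close>, so X p
    lies in the range; it remains to compare dimensions.\<close>
  have "s i z0 \<in> ?R p" if "i < k" for i
  proof -
    have "isCont (\<lambda>z. s i z $ a) z0" for a
      using holomorphic_on_imp_continuous_on[OF hol[OF that]] U by (simp add: continuous_on_eq_continuous_at)
    then have s: "((\<lambda>z. s i z) \<longlongrightarrow> s i z0) (at z0)"
      by (intro vec_tendstoI) (simp add: isCont_def)
    have "eventually (\<lambda>z. Q (c z) *v s i z = s i z) (at z0)"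
      using ev_F ev_U
    proof eventually_elim
      case (elim z)
      then have "s i z \<in> X (c z)"
        using that span by (auto intro: vec.span_base)
      then show ?case
        using generic elim by auto
    qed
    moreover have "((\<lambda>z. Q (c z) *v s i z) \<longlongrightarrow> Q p *v s i z0) (at z0)"
      by (rule bounded_bilinear.tendsto[OF bounded_bilinear_matrix_vector_mult Q0 s])
    ultimately have "((\<lambda>z. s i z) \<longlongrightarrow> Q p *v s i z0) (at z0)"
      by (rule Lim_transform_eventually[rotated])
    then show ?thesis
      using s tendsto_unique[OF at_neq_bot] by auto
  qed
  then have "vec.span ((\<lambda>i. s i z0) ` {..<k}) \<subseteq> ?R p"
    by (intro vec.span_minimal sub) auto
  then have X_sub: "X p \<subseteq> ?R p"
    using span[OF U(2)] p by simp
  \<comment> \<open>The threshold makes Q (c z) - Q p strictly contracting.\<close>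
  have "eventually (\<lambda>z. dist (Q (c z)) (Q p) < 1 / K) (at z0)"
    using Q0 K(2) by (intro tendstoD) auto
  with ev_F have "eventually (\<lambda>z. c z \<notin> F \<and> dist (Q (c z)) (Q p) < 1 / K) (at z0)"
    by (rule eventually_conj)
  then have "\<exists>z. c z \<notin> F \<and> dist (Q (c z)) (Q p) < 1 / K"
    by (intro eventually_happens'[of "at z0"]) auto
  then obtain z where z: "c z \<notin> F" "norm (Q (c z) - Q p) * K < 1"
    using K(2) by (auto simp: dist_norm field_simps)
  \<comment> \<open>Differences of vectors in the range are fixed by Q p. If Q (c z) kills one, it
    is minus its own image under the contraction and must vanish.\<close>
  have "inj_on ((*v) (Q (c z))) (?R p)"
  proof (rule inj_onI)
    fix x y assume xy: "x \<in> ?R p" "y \<in> ?R p" "Q (c z) *v x = Q (c z) *v y"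
    let ?w = "x - y"
    have "?w = - ((Q (c z) - Q p) *v ?w)"
      using xy by (simp add: matrix_vector_mult_diff_distrib matrix_vector_mult_diff_rdistrib)
    then have "norm ?w \<le> norm (Q (c z) - Q p) * K * norm ?w"
      using K(1)[of "Q (c z) - Q p" ?w] by (metis mult.assoc mult.commute norm_minus_cancel)
    then have "(1 - norm (Q (c z) - Q p) * K) * norm ?w \<le> 0"
      by (simp add: algebra_simps)
    then show "x = y"
      using z(2) by (simp add: mult_le_0_iff)
  qed
  then have "vec.dim (?R p) = vec.dim ((*v) (Q (c z)) ` ?R p)"
    using vec.span_eq_iff[THEN iffD2, OF sub]
    by (intro vec.dim_image_eq[symmetric] matrix_vector_mul_linear_gen) metis
  also have "\<dots> \<le> vec.dim (X (c z))"
    unfolding generic[OF z(1)] by (intro vec.dim_subset) (auto simp: matrix_vector_mul_assoc idem)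
  finally have "vec.dim (?R p) \<le> vec.dim (X p)"
    by (simp add: dim_X)
  then show ?thesis
    by (intro vec.subspace_dim_equal X_sub dim_X sub)
qed

section \<open>Comparison of the two metrics\<close>

lemma extended_solution_chart:
  fixes \<psi> :: "riemann_sphere \<Rightarrow> complex^'n^'n"
  assumes \<psi>: "sphere_smooth \<psi>" "\<And>p. \<psi> p \<in> unitary_group"
    and \<Psi>: "extended_solution \<psi> \<Psi>" and c: "c \<in> sphere_charts" and \<zeta>: "\<zeta> \<in> sphere 0 1"
  shows extended_solution_unitary: "\<Psi> p \<zeta> \<in> unitary_group"
    and extended_solution_smooth: "smooth_on UNIV (\<lambda>x. \<Psi> (c x) \<zeta>)"
    and extended_solution_derivative: "frechet_derivative (\<lambda>x. \<Psi> (c x) \<zeta>) (at z) v =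
      \<Psi> (c z) \<zeta> ** (((1 - inverse \<zeta>) * v) *\<^sub>M A_z (\<lambda>x. \<psi> (c x)) z -
        ((1 - \<zeta>) * cnj v) *\<^sub>M ctranspose (A_z (\<lambda>x. \<psi> (c x)) z))"
proof -
  show unitary: "\<Psi> p \<zeta> \<in> unitary_group" for p
    using \<Psi> \<zeta> by (auto simp: extended_solution_def loop_group_def)
  obtain t where t: "\<zeta> = cis t"
    using \<zeta> sphere_cis by blast
  show "smooth_on UNIV (\<lambda>x. \<Psi> (c x) \<zeta>)"
    using \<Psi> c smooth_slice[of "\<lambda>(z, t). \<Psi> (c z) (cis t)" t] by (simp add: extended_solution_def t)
  have "(\<lambda>x. \<psi> (c x)) differentiable (at z)"
    using \<psi>(1) c by (intro smooth_differentiable) (auto simp: sphere_smooth_def)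
  then have A_zbar: "A_zbar (\<lambda>x. \<psi> (c x)) z = - ctranspose (A_z (\<lambda>x. \<psi> (c x)) z)"
    by (intro A_zbar_eq \<psi>(2))
  have "frechet_derivative (\<lambda>x. \<Psi> (c x) \<zeta>) (at z) v =
      \<Psi> (c z) \<zeta> ** (matrix_inv (\<Psi> (c z) \<zeta>) ** frechet_derivative (\<lambda>x. \<Psi> (c x) \<zeta>) (at z) v)"
    using unitary[of "c z"] by (simp add: unitary_matrix_inv matrix_mul_assoc unitary_group_def)
  also have "matrix_inv (\<Psi> (c z) \<zeta>) ** frechet_derivative (\<lambda>x. \<Psi> (c x) \<zeta>) (at z) v =
      ((1 - inverse \<zeta>) * v) *\<^sub>M A_z (\<lambda>x. \<psi> (c x)) z + ((1 - \<zeta>) * cnj v) *\<^sub>M A_zbar (\<lambda>x. \<psi> (c x)) z"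
    using \<Psi> c \<zeta> unfolding extended_solution_def by blast
  finally show "frechet_derivative (\<lambda>x. \<Psi> (c x) \<zeta>) (at z) v =
      \<Psi> (c z) \<zeta> ** (((1 - inverse \<zeta>) * v) *\<^sub>M A_z (\<lambda>x. \<psi> (c x)) z -
        ((1 - \<zeta>) * cnj v) *\<^sub>M ctranspose (A_z (\<lambda>x. \<psi> (c x)) z))"
    by (simp add: A_zbar)
qed

text \<open>The sphere carries no nonzero holomorphic quadratic differential; regularity at infinity
  comes from holomorphy in the other chart.\<close>

lemma trace_A_z_squared:
  fixes \<psi> :: "riemann_sphere \<Rightarrow> complex^'n^'n"
  assumes \<psi>: "sphere_smooth \<psi>" "\<And>p. \<psi> p \<in> unitary_group" and \<Psi>: "extended_solution \<psi> \<Psi>"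
    and c: "c \<in> sphere_charts"
  shows "trace (A_z (\<lambda>x. \<psi> (c x)) z ** A_z (\<lambda>x. \<psi> (c x)) z) = 0"
proof -
  let ?A = "\<lambda>c. A_z (\<lambda>x. \<psi> (c x))"
  have smooth: "smooth_on UNIV (\<lambda>x. \<psi> (c x))" if "c \<in> sphere_charts" for c
    using that \<psi>(1) by (simp add: sphere_smooth_def)
  have hol: "(\<lambda>z. trace (?A c z ** ?A c z)) holomorphic_on UNIV" if "c \<in> sphere_charts" for c
  proof (rule quadratic_differential_holomorphic[where F = "\<lambda>\<zeta> x. \<Psi> (c x) \<zeta>"])
    show "?A c differentiable (at z)" for z
      by (rule A_z_differentiable[OF \<psi>(2) smooth[OF that]])
  qed (rule extended_solution_chart[OF \<psi> \<Psi> that], assumption)+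
  obtain c' where c': "c' \<in> sphere_charts" "\<And>x. x \<noteq> 0 \<Longrightarrow> c x = c' (1 / x)"
    using c that[of chart_zero] that[of chart_infinity]
    by (auto simp: sphere_charts_def chart_zero_def chart_infinity_def)
  show ?thesis
  proof (rule quadratic_differential_zero[OF hol[OF c], of "\<lambda>z. trace (?A c' z ** ?A c' z)"])
    show "isCont (\<lambda>z. trace (?A c' z ** ?A c' z)) 0"
      using holomorphic_on_imp_continuous_on[OF hol[OF c'(1)]] by (simp add: continuous_on_eq_continuous_at)
    fix z :: complex assume z: "z \<noteq> 0"
    have "?A c z = (- 1 / z\<^sup>2) *\<^sub>M ?A c' (1 / z)"
      by (rule A_z_chart_change[OF \<psi>(2) \<psi>(2) smooth_differentiable[OF smooth[OF c'(1)]] _ z]) (simp add: c'(2))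
    then show "trace (?A c z ** ?A c z) = trace (?A c' (1 / z) ** ?A c' (1 / z)) / z ^ 4"
      by (simp add: power2_eq_square power4_eq_xxxx)
  qed
qed

theorem lemma3p1:
  fixes \<psi> :: "riemann_sphere \<Rightarrow> complex^'n^'n"
    and \<Psi> :: "riemann_sphere \<Rightarrow> complex \<Rightarrow> complex^'n^'n"
    and deg :: "'r::finite \<Rightarrow> nat"
    and X :: "riemann_sphere \<Rightarrow> (complex^('r \<times> 'n)) set"
    and r k :: nat
  assumes "harmonic_map \<psi>"
    and "has_uniton_number \<psi> r" and "r > 0"
    and "normalized_extended_solution \<psi> r \<Psi>"
    and "bij_betw deg UNIV {..<r}"
    and "corresponding_map deg k \<Psi> X"
  shows "(sphere_immersion \<psi> \<longleftrightarrow> grassmann_immersion X) \<and>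
    (sphere_immersion \<psi> \<longrightarrow>
      (\<forall>c\<in>sphere_charts. \<forall>z u v.
         grassmann_pullback_metric X c z u v = pullback_metric \<psi> c z u v))"
proof -
  have \<psi>: "sphere_smooth \<psi>" "\<And>p. \<psi> p \<in> unitary_group"
    using assms(1) by (auto simp: harmonic_map_def)
  have \<Psi>: "extended_solution \<psi> \<Psi>"
    and W: "\<And>p. loop_image (\<lambda>\<zeta>. mat (\<zeta> ^ r)) H_plus \<subseteq> loop_image (\<Psi> p) H_plus"
      "\<And>p. loop_image (\<Psi> p) H_plus \<subseteq> H_plus"
    using assms(4) by (auto simp: normalized_extended_solution_def W_fiber_def)
  obtain F where X: "holomorphic_to_grassmannian k X" "finite F"
    "\<And>p. p \<notin> F \<Longrightarrow> X p = {v. poly_of_vec deg v \<in> loop_image (\<Psi> p) H_plus}"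
    using assms(6) by (auto simp: corresponding_map_def W_fiber_def)
  \<comment> \<open>Defined at every point, exceptional or not; the explicit zero outside 0..r is
    what the shifted indices in the block columns rely on.\<close>
  define T where "T p k = (if k \<in> {0..int r}
      then \<chi> i j. circle_coeff (\<lambda>\<zeta>. \<Psi> p \<zeta> $ i $ j) (- k) / (2 * pi) else 0)" for p k
  have loop: "unitary_polynomial_loop (\<Psi> p) (T p) r" for p
  proof -
    have "smooth_on UNIV (\<lambda>t::real. \<Psi> p (cis t))" and unitary: "\<And>\<zeta>. \<zeta> \<in> sphere 0 1 \<Longrightarrow> \<Psi> p \<zeta> \<in> unitary_group"
      using \<Psi> by (auto simp: extended_solution_def loop_group_def)
    then have "continuous_on {0..2 * pi} (\<lambda>t. \<Psi> p (cis t))"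
      using smooth_continuous continuous_on_subset by blast
    then interpret unitary_loop "\<Psi> p"
      by unfold_locales (auto simp: continuous_on_circle_iff unitary)
    show ?thesis
    proof
      show "\<Psi> p z = (\<Sum>k=0..int r. z powi k *\<^sub>M T p k)" if "z \<in> sphere 0 1" for z
        by (subst polynomial[OF W that]) (auto simp: T_def intro!: sum.cong)
    qed (use unitary in \<open>auto simp: T_def\<close>)
  qed
  define Q where "Q p = block_proj deg r (T p)" for p
  have proj: "hermitian_projection (Q p)" for p
  proof -
    interpret unitary_polynomial "T p" r deg
      by (rule unitary_polynomial_loop.unitary_polynomial[OF loop assms(5)])
    show ?thesis
      by unfold_locales (simp_all add: Q_def proj_idem ctranspose_proj)
  qed
  have deg_less: "deg a < r" for a
    using assms(5) by (auto simp: bij_betw_def)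
  let ?A = "\<lambda>c. A_z (\<lambda>x. \<psi> (c x))"
  define S where "S c z = - (block_col deg (T (c z)) (-1) ** ?A c z ** ctranspose (block_col deg (T (c z)) 0))" for c z
  have Q_der: "((\<lambda>x. Q (c x)) has_derivative (\<lambda>v. v *\<^sub>M S c z + cnj v *\<^sub>M ctranspose (S c z))) (at z)"
    and S: "S c z ** S c z = 0" "trace (S c z ** ctranspose (S c z)) = trace (?A c z ** ctranspose (?A c z))"
    if c: "c \<in> sphere_charts" for c z
  proof -
    have der: "((\<lambda>x. \<Psi> (c x) \<zeta>) has_derivative (\<lambda>v. \<Psi> (c z) \<zeta> **
        (((1 - inverse \<zeta>) * v) *\<^sub>M ?A c z - ((1 - \<zeta>) * cnj v) *\<^sub>M ctranspose (?A c z)))) (at z)"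
      if "\<zeta> \<in> sphere 0 1" for \<zeta>
      using smooth_has_derivative[OF extended_solution_smooth[OF \<psi> \<Psi> c that]]
      by (simp add: has_derivative_eq_rhs extended_solution_derivative[OF \<psi> \<Psi> c that, abs_def])
    note coeff = coefficient_derivative[where \<Gamma> = "\<lambda>x. \<Psi> (c x)" and T = "\<lambda>x. T (c x)", OF loop der]
    have "T p k = 0" if "k < 0" for p k
      using that by (simp add: T_def)
    then show "((\<lambda>x. Q (c x)) has_derivative (\<lambda>v. v *\<^sub>M S c z + cnj v *\<^sub>M ctranspose (S c z))) (at z)"
      unfolding Q_def S_def
      by (intro has_derivative_block_proj[where T = "\<lambda>x. T (c x)"] coeff(1) deg_less) auto
    note second_form = unitary_polynomial.trace_second_fundamental_form[OF
        unitary_polynomial_loop.unitary_polynomial[OF loop assms(5)] coeff(2,3)]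
    show "S c z ** S c z = 0"
      unfolding S_def by (rule second_form(1))
    show "trace (S c z ** ctranspose (S c z)) = trace (?A c z ** ctranspose (?A c z))"
      unfolding S_def by (rule second_form(2))
  qed
  have X_range: "X p = {v. Q p *v v = v}" for p
  proof (rule holomorphic_extension_range[OF X(1,2)])
    show "X p = {v. Q p *v v = v}" if "p \<notin> F" for p
      using X(3)[OF that] unitary_polynomial_loop.poly_of_vec_mem_iff[OF loop assms(5)] by (simp add: Q_def)
    show "continuous_on UNIV (\<lambda>z. Q (c z))" if "c \<in> sphere_charts" for c
      using has_derivative_continuous[OF Q_der[OF that]] by (simp add: continuous_on_eq_continuous_at)
    show "Q p ** Q p = Q p" for p
      using proj by (rule hermitian_projection.idem)
  qed
  have cartan: "cartan_embedding (X p) = 2 *\<^sub>M Q p - mat 1" and cartan_unitary: "cartan_embedding (X p) \<in> unitary_group" for p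
    unfolding X_range hermitian_projection.cartan_embedding_range[OF proj]
    by (rule refl hermitian_projection.cartan_unitary[OF proj])+
  have cartan_der: "((\<lambda>x. cartan_embedding (X (c x))) has_derivative
      (\<lambda>v. 2 *\<^sub>M (v *\<^sub>M S c z + cnj v *\<^sub>M ctranspose (S c z)))) (at z)" if "c \<in> sphere_charts" for c z
    unfolding cartan using Q_der[OF that]
    by (auto intro!: derivative_eq_intros bounded_linear.has_derivative[OF bounded_linear_cscale])
  have \<psi>_diff: "(\<lambda>x. \<psi> (c x)) differentiable (at z)" if "c \<in> sphere_charts" for c z
    using \<psi>(1) that by (intro smooth_differentiable) (auto simp: sphere_smooth_def)
  have metric: "grassmann_pullback_metric X c z u v = pullback_metric \<psi> c z u v"
    if c: "c \<in> sphere_charts" for c z u v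
  proof -
    have fd: "frechet_derivative (\<lambda>x. cartan_embedding (X (c x))) (at z) =
        (\<lambda>v. 2 *\<^sub>M (v *\<^sub>M S c z + (1 * cnj v) *\<^sub>M ctranspose (S c z)))"
      using frechet_derivative_at[OF cartan_der[OF c]] by simp
    \<comment> \<open>The 2 of the Cartan embedding enters squared and meets the 2 of
      \<open>conformal_trace\<close> and the 1/8 of the metric: the constant is 1.\<close>
    have "grassmann_pullback_metric X c z u v = Re (u * cnj v) * Re (trace (S c z ** ctranspose (S c z)))"
      unfolding grassmann_pullback_metric_def pullback_metric_def h_metric_unitary[OF cartan_unitary] fd
      using conformal_trace[of "S c z" 1 u v] S(1)[OF c]
      by simp
    also have "\<dots> = Re (u * cnj v) * Re (trace (?A c z ** ctranspose (?A c z)))"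
      by (simp add: S(2)[OF c])
    also have "\<dots> = pullback_metric \<psi> c z u v"
    proof -
      \<comment> \<open>The same factor 2, here from the 1/2 in the definition of
        \<open>A_z\<close>, so the constant is again 1.\<close>
      have fd: "matrix_inv (\<psi> (c z)) ** frechet_derivative (\<lambda>x. \<psi> (c x)) (at z) v =
          2 *\<^sub>M (v *\<^sub>M ?A c z + (- 1 * cnj v) *\<^sub>M ctranspose (?A c z))" for v
        using frechet_derivative_A_z[OF \<psi>(2) \<psi>_diff[OF c], of z v] \<psi>(2)[of "c z"]
        by (simp add: unitary_matrix_inv matrix_mul_assoc unitary_group_def)
      show ?thesis
        unfolding pullback_metric_def h_metric_def h_lie_def fd
        using conformal_trace[OF trace_A_z_squared[OF \<psi> \<Psi> c, of z], where e = "-1" and u = u and v = v]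
        by simp
    qed
    finally show ?thesis .
  qed
  have "sphere_immersion \<psi> \<longleftrightarrow> grassmann_immersion X"
    unfolding grassmann_immersion_def
    using metric cartan_der
    by (simp add: sphere_immersion_iff[OF \<psi>(2) \<psi>_diff]
        sphere_immersion_iff[OF cartan_unitary differentiableI[OF cartan_der]] grassmann_pullback_metric_def)
  then show ?thesis
    using metric by blast
qed

end
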